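(* Let $p$ be an odd prime and let $m,b,c\in\mathbb{Z}$ with $m\not\equiv 0\pmod p$. (1) If $m\equiv 4b\pmod p$, then $$\sum_{k=0}^{p-1}\frac{\binom{2k}{k}}{m^k}T_k(b,c)\equiv\begin{cases}\left(\frac{m}{p}\right)2x\,c^{(p-1)/4}\pmod p&\text{if } p\equiv 1\pmod 4 \text{ and } p=x^2+y^2 \text{ with } x,y\in\mathbb{Z},\ x\equiv1\pmod 4,\\ 0\pmod p&\text{if } p\equiv3\pmod 4.\end{cases}$$ (2) If $m\not\equiv 4b\pmod p$, then $$\sum_{k=0}^{p-1}\frac{\binom{2k}{k}}{m^k}T_k(b,c)\equiv\left(\frac{m(m-4b)}{p}\right)\sum_{k=0}^{p-1}\frac{\binom{4k}{2k}\binom{2k}{k}c^k}{(m-4b)^{2k}}\pmod p.$$ (3) If $d=b^2-4c\not\equiv0\pmod p$, then for every positive integer $h$, $$\sum_{k=0}^{p-1}\frac{\binom{2k}{k}^hT_{2k}(b,c)}{m^k}\equiv\left(\frac{(-1)^h d m}{p}\right)\sum_{k=0}^{p-1}\frac{\binom{2k}{k}^hT_{2k}(b,c)}{(16^h d^2/m)^k}\pmod p.$$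
   Context: For integers $b,c$ and $n\ge 0$, the generalized central trinomial coefficient is $T_n(b,c)=[x^n](x^2+bx+c)^n=\sum_{k=0}^{\lfloor n/2\rfloor}\binom{n}{2k}\binom{2k}{k}b^{n-2k}c^k$ (with $0^0=1$), where $[x^n]$ denotes the coefficient of $x^n$. $\left(\frac{\cdot}{p}\right)$ is the Legendre symbol. Congruences are between rational numbers with denominators prime to $p$ (in the localization $\mathbb{Z}_{(p)}$). *)

theory Defs
  imports
    "HOL-Computational_Algebra.Polynomial"
    "HOL-Number_Theory.Number_Theory"
begin

definition central_trinomial :: "int \<Rightarrow> int \<Rightarrow> nat \<Rightarrow> int" where
  "central_trinomial b c n = Polynomial.coeff ([:c, b, 1:] ^ n) n"

(* For prime p: membership in the localization of the integers at (p). quotient_of yields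
   numerator and denominator in lowest terms. *)
definition p_integral :: "nat \<Rightarrow> rat \<Rightarrow> bool" where
  "p_integral p q \<longleftrightarrow> coprime (snd (quotient_of q)) (int p)"

(* Congruence modulo the ideal generated by p in that localization; it includes the claim that
   both sides have denominator prime to p. The library's cong is of no use here, since p is
   invertible in the field of rationals. *)
definition rat_cong :: "nat \<Rightarrow> rat \<Rightarrow> rat \<Rightarrow> bool" where
  "rat_cong p x y \<longleftrightarrow>
     p_integral p x \<and> p_integral p y \<and> (\<exists>r. p_integral p r \<and> x - y = of_nat p * r)"

end

theory Submission
  imports Defs
begin

text \<open>
  Let \<open>n = (p - 1) / 2\<close>. Modulo \<open>p\<close>, \<open>binom(2k, k)\<close> is \<open>binom(n, k) (-4)^k\<close> for \<open>k < p\<close>, so the sum in (1)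
  and (2) is \<open>m^(-n)\<close> times the coefficient of \<open>x^n\<close> in \<open>(m x - 4 (x^2 + b x + c))^n\<close>, again a central
  trinomial coefficient. Expanding it gives (2) at once. If \<open>m = 4 b\<close>, only the term \<open>binom(n, n/2)\<close>
  survives, which by Gauss is \<open>2 x\<close>: up to sign it is the Jacobsthal sum of the Legendre symbols
  of \<open>t (t^2 + 1)\<close>, and the second moment of the sums with \<open>t (t^2 + a)\<close> exhibits \<open>p\<close> as a sum of
  two squares.
  For (3), \<open>T_k(b, c)\<close> is modulo \<open>p\<close> the coefficient of \<open>x^k\<close> in \<open>(1 - 2 b x + d x^2)^n\<close>, and the symmetry
  of this polynomial under \<open>x \<mapsto> 1 / (d x)\<close> makes the terms of index \<open>k\<close> and \<open>n - k\<close> correspond.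
\<close>

section \<open>Congruences between rational numbers\<close>

text \<open>Division is removed at the outset: powers of 1/m, of 1/(m - 4b) and of m/(16^h d^2) are
  replaced by powers of integers inverse modulo p, so that all the work is on integer congruences.
  Their common source is that n represents -1/2 modulo p. Identities for binom(-1/2, k) and for the
  generating function of T_k, which is a power with exponent -1/2, turn into statements about n-th
  powers of polynomials; Euler's criterion turns n-th powers of integers into Legendre symbols. The
  obstacle in (1) is that a congruence modulo p alone cannot single out x. The Jacobsthal sums are
  therefore treated as exact integers: half of such a sum is an integer X with p = X^2 + Y^2, and p
  has essentially one such representation. What remains is the sign of X, a question modulo 4. It is
  settled on the half system {1..n}, where all terms except those at t = 1 and at t^2 = -1 come in
  equal pairs.\<close>

lemma p_integral_iff:
  assumes "prime p"
  shows "p_integral p q \<longleftrightarrow> (\<exists>a b. q = of_int a / of_int b \<and> \<not> int p dvd b)"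
proof
  assume "p_integral p q"
  moreover obtain a b where ab: "quotient_of q = (a, b)" by (cases "quotient_of q")
  ultimately have "coprime b (int p)" by (simp add: p_integral_def)
  moreover have "\<not> is_unit (int p)" using assms by auto
  ultimately have "\<not> int p dvd b"
    by (metis coprime_common_divisor dvd_refl)
  then show "\<exists>a b. q = of_int a / of_int b \<and> \<not> int p dvd b"
    using quotient_of_div[OF ab] by blast
next
  assume "\<exists>a b. q = of_int a / of_int b \<and> \<not> int p dvd b"
  then obtain a b where q: "q = of_int a / of_int b" and b: "\<not> int p dvd b" by blast
  obtain a' b' where ab': "quotient_of q = (a', b')" by (cases "quotient_of q")
  have "b \<noteq> 0" "b' > 0"
    using b quotient_of_denom_pos[OF ab'] by auto
  then have "rat_of_int (a * b') = of_int (a' * b)"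
    using q quotient_of_div[OF ab'] by (simp add: field_simps)
  \<comment> \<open>The reduced denominator divides every denominator of q, so any representation
    with denominator prime to p is good enough.\<close>
  then have "b' dvd a' * b"
    by (metis dvd_triv_right of_int_eq_iff)
  then have "b' dvd b"
    using quotient_of_coprime[OF ab'] by (simp add: coprime_dvd_mult_right_iff coprime_commute)
  then have "\<not> int p dvd b'" using b dvd_trans by blast
  then have "coprime b' (int p)"
    using assms prime_imp_coprime[of "int p" b'] by (simp add: coprime_commute)
  then show "p_integral p q" by (simp add: p_integral_def ab')
qed

lemma p_integral_of_int: "p_integral p (of_int a)"
  by (simp add: p_integral_def)

lemma p_integral_add:
  assumes "prime p" "p_integral p x" "p_integral p y"
  shows "p_integral p (x + y)"
proof -
  obtain a b c d where "x = of_int a / of_int b" "\<not> int p dvd b" "y = of_int c / of_int d" "\<not> int p dvd d"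
    using assms p_integral_iff by blast
  moreover from this have "b \<noteq> 0" "d \<noteq> 0" by auto
  ultimately have "x + y = of_int (a * d + c * b) / of_int (b * d)" "\<not> int p dvd b * d"
    using assms(1) by (auto simp: field_simps prime_dvd_mult_iff)
  then show ?thesis using p_integral_iff[OF assms(1)] by blast
qed

lemma p_integral_mult:
  assumes "prime p" "p_integral p x" "p_integral p y"
  shows "p_integral p (x * y)"
proof -
  obtain a b c d where "x = of_int a / of_int b" "\<not> int p dvd b" "y = of_int c / of_int d" "\<not> int p dvd d"
    using assms p_integral_iff by blast
  then have "x * y = of_int (a * c) / of_int (b * d)" "\<not> int p dvd b * d"
    using assms(1) by (auto simp: prime_dvd_mult_iff)
  then show ?thesis using p_integral_iff[OF assms(1)] by blast
qed

lemma p_integral_minus: "prime p \<Longrightarrow> p_integral p x \<Longrightarrow> p_integral p (- x)"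
  using p_integral_mult[of p "of_int (-1)" x] p_integral_of_int[of p "-1"] by simp

lemma rat_cong_refl: "p_integral p x \<Longrightarrow> rat_cong p x x"
  using p_integral_of_int[of p 0] by (auto simp: rat_cong_def intro!: exI[of _ 0])

lemma rat_cong_of_int: "[a = b] (mod int p) \<Longrightarrow> rat_cong p (of_int a) (of_int b)"
proof -
  assume "[a = b] (mod int p)"
  then obtain k where "a - b = int p * k" by (auto simp: cong_iff_dvd_diff)
  then have "rat_of_int a - of_int b = of_nat p * of_int k"
    by (metis of_int_diff of_int_mult of_int_of_nat_eq)
  then show ?thesis
    using p_integral_of_int by (auto simp: rat_cong_def)
qed

lemma rat_cong_sym:
  assumes "prime p" "rat_cong p x y"
  shows "rat_cong p y x"
proof -
  obtain r where "x - y = of_nat p * r" "p_integral p r"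
    using assms(2) by (auto simp: rat_cong_def)
  then have "y - x = of_nat p * (- r)" "p_integral p (- r)"
    using p_integral_minus[OF assms(1)] by (auto simp: algebra_simps)
  then show ?thesis using assms(2) unfolding rat_cong_def by blast
qed

lemma rat_cong_trans:
  assumes "prime p" "rat_cong p x y" "rat_cong p y z"
  shows "rat_cong p x z"
proof -
  obtain r s where "x - y = of_nat p * r" "p_integral p r" "y - z = of_nat p * s" "p_integral p s"
    using assms(2,3) by (auto simp: rat_cong_def)
  then have "x - z = of_nat p * (r + s)" "p_integral p (r + s)"
    using p_integral_add[OF assms(1)] by (auto simp: algebra_simps)
  then show ?thesis using assms(2,3) unfolding rat_cong_def by blast
qed

lemma rat_cong_add:
  assumes "prime p" "rat_cong p x y" "rat_cong p u v"
  shows "rat_cong p (x + u) (y + v)"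
proof -
  obtain r s where "x - y = of_nat p * r" "p_integral p r" "u - v = of_nat p * s" "p_integral p s"
    using assms(2,3) by (auto simp: rat_cong_def)
  then have "(x + u) - (y + v) = of_nat p * (r + s)" "p_integral p (r + s)"
    using p_integral_add[OF assms(1)] by (auto simp: algebra_simps)
  then show ?thesis
    using assms(2,3) p_integral_add[OF assms(1)] unfolding rat_cong_def by blast
qed

lemma rat_cong_mult:
  assumes "prime p" "rat_cong p x y" "rat_cong p u v"
  shows "rat_cong p (x * u) (y * v)"
proof -
  obtain r s where rs: "x - y = of_nat p * r" "p_integral p r" "u - v = of_nat p * s" "p_integral p s"
    using assms(2,3) by (auto simp: rat_cong_def)
  have "x * u - y * v = (x - y) * u + y * (u - v)"
    by (simp add: algebra_simps)
  also have "\<dots> = of_nat p * (r * u + y * s)"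
    unfolding rs by (simp add: algebra_simps)
  finally have "x * u - y * v = of_nat p * (r * u + y * s)" .
  moreover have "p_integral p (r * u + y * s)"
    using assms rs unfolding rat_cong_def by (intro p_integral_add p_integral_mult) auto
  ultimately show ?thesis
    using assms p_integral_mult[OF assms(1)] unfolding rat_cong_def by blast
qed

lemma rat_cong_power:
  assumes "prime p" "rat_cong p x y"
  shows "rat_cong p (x ^ k) (y ^ k)"
proof (induction k)
  case 0
  show ?case using rat_cong_of_int[of 1 1 p] by simp
qed (simp add: rat_cong_mult assms)

lemma rat_cong_sum:
  assumes "prime p" "\<And>k. k \<in> A \<Longrightarrow> rat_cong p (f k) (g k)"
  shows "rat_cong p (sum f A) (sum g A)"
  using assms(2)
proof (induction A rule: infinite_finite_induct)
  case (insert k A)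
  then show ?case by (simp add: rat_cong_add[OF assms(1)])
qed (use rat_cong_of_int[of 0 0 p] in simp_all)

text \<open>Multiply 1 = a b by 1/a, which is p-integral because a is a unit modulo p. This is the
  bridge from division to integer inverses.\<close>

lemma rat_cong_inverse_of_int:
  assumes "prime p" "[a * b = 1] (mod int p)"
  shows "rat_cong p (inverse (of_int a)) (of_int b)"
proof -
  have "\<not> int p dvd 1" using assms(1) by auto
  then have "\<not> int p dvd a"
    using cong_dvd_iff[OF assms(2)] by auto
  then have "a \<noteq> 0" by auto
  have int: "p_integral p (inverse (of_int a))"
    unfolding p_integral_iff[OF assms(1)] using \<open>\<not> int p dvd a\<close>
    by (intro exI[of _ 1] exI[of _ a]) (simp add: inverse_eq_divide)
  have "rat_cong p (inverse (of_int a) * of_int 1) (inverse (of_int a) * of_int (a * b))"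
    by (rule rat_cong_mult[OF assms(1) rat_cong_refl[OF int] rat_cong_of_int[OF cong_sym[OF assms(2)]]])
  with \<open>a \<noteq> 0\<close> show ?thesis by (simp flip: mult.assoc)
qed

lemma rat_cong_of_int_inverse_power:
  assumes "prime p" "[a * b = 1] (mod int p)"
  shows "rat_cong p (of_int u * inverse (of_int a) ^ k) (of_int (u * b ^ k))"
  unfolding of_int_mult of_int_power
  by (intro rat_cong_mult rat_cong_power rat_cong_inverse_of_int rat_cong_of_int cong_refl assms)

lemma rat_cong_sum_of_int:
  assumes "prime p" "\<And>k. k \<in> A \<Longrightarrow> rat_cong p (f k) (of_int (g k))"
  shows "rat_cong p (sum f A) (of_int (sum g A))"
  unfolding of_int_sum by (intro rat_cong_sum assms)

text \<open>The form in which each part of the theorem is reduced to an integer congruence: both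
  rational sides are replaced by integers.\<close>

lemma rat_cong_via_int:
  assumes "prime p" "rat_cong p x (of_int a)" "[a = b] (mod int p)" "rat_cong p y (of_int b)"
  shows "rat_cong p x y"
  using rat_cong_trans[OF assms(1) rat_cong_trans[OF assms(1,2) rat_cong_of_int[OF assms(3)]]]
    rat_cong_sym[OF assms(1,4)] by blast

section \<open>Coefficients of powers of quadratic polynomials\<close>

lemma coeff_binomial_square_power:
  fixes c q :: "'a :: comm_ring_1"
  shows "Polynomial.coeff ([:c, 0, q:] ^ i) i
    = (if even i then of_nat (i choose (i div 2)) * (q * c) ^ (i div 2) else 0)"
proof -
  have eq: "[:c, 0, q:] = Polynomial.monom q 2 + [:c:]"
    by (simp add: monom_altdef numeral_2_eq_2)
  have "Polynomial.coeff ([:c, 0, q:] ^ i) i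
      = (\<Sum>k\<le>i. of_nat (i choose k) * Polynomial.coeff (Polynomial.monom q 2 ^ k * [:c:] ^ (i - k)) i)"
    unfolding eq binomial_ring coeff_sum
    by (intro sum.cong refl) (simp add: mult.assoc of_nat_mult_conv_smult)
  also have "\<dots> = (\<Sum>k\<le>i. if i = 2 * k then of_nat (i choose k) * (q * c) ^ k else 0)"
  proof (intro sum.cong refl)
    fix k assume "k \<in> {..i}"
    have "Polynomial.coeff (Polynomial.monom q 2 ^ k * [:c:] ^ (i - k)) i = (if 2 * k = i then q ^ k * c ^ (i - k) else 0)"
      by (simp add: monom_power poly_const_pow mult.commute[of "Polynomial.monom _ _"])
    then show "of_nat (i choose k) * Polynomial.coeff (Polynomial.monom q 2 ^ k * [:c:] ^ (i - k)) i
       = (if i = 2 * k then of_nat (i choose k) * (q * c) ^ k else 0)"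
      by (auto simp: power_mult_distrib)
  qed
  also have "\<dots> = (if even i then of_nat (i choose (i div 2)) * (q * c) ^ (i div 2) else 0)"
  proof (cases "even i")
    case True
    then have "(\<Sum>k\<le>i. if i = 2 * k then of_nat (i choose k) * (q * c) ^ k else 0)
      = (\<Sum>k\<le>i. if k = i div 2 then of_nat (i choose k) * (q * c) ^ k else 0)"
      by (intro sum.cong) auto
    with True show ?thesis by simp
  next
    case False
    then show ?thesis by (auto intro!: sum.neutral)
  qed
  finally show ?thesis .
qed

text \<open>Split off the linear term: if i factors contribute c + q x^2 and n - i contribute b x,
  then x^i is wanted from the i-th power of c + q x^2, which forces i = 2j. The leading coefficient
  stays general because -4 is needed later. Terms with 2j > n vanish through the binomial
  coefficient, so the range can be \<open>j \<le> n\<close>.\<close>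

lemma coeff_trinomial_power_middle:
  fixes c b q :: "'a :: comm_ring_1"
  shows "Polynomial.coeff ([:c, b, q:] ^ n) n
    = (\<Sum>j\<le>n. of_nat (n choose (2 * j)) * of_nat ((2 * j) choose j) * b ^ (n - 2 * j) * (q * c) ^ j)"
proof -
  define f where "f i = of_nat (n choose i) * b ^ (n - i) * Polynomial.coeff ([:c, 0, q:] ^ i) i" for i
  have eq: "[:c, b, q:] = [:c, 0, q:] + Polynomial.monom b 1"
    by (simp add: monom_altdef)
  have "Polynomial.coeff ([:c, b, q:] ^ n) n = (\<Sum>i\<le>n. f i)"
    unfolding eq binomial_ring coeff_sum
  proof (intro sum.cong refl)
    fix i assume "i \<in> {..n}"
    then have "Polynomial.coeff (Polynomial.monom (b ^ (n - i)) (n - i) * [:c, 0, q:] ^ i) n = b ^ (n - i) * Polynomial.coeff ([:c, 0, q:] ^ i) i"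
      by (simp add: coeff_monom_mult)
    then show "Polynomial.coeff (of_nat (n choose i) * [:c, 0, q:] ^ i * Polynomial.monom b 1 ^ (n - i)) n = f i"
      by (simp add: f_def monom_power mult.assoc of_nat_mult_conv_smult mult.commute[of _ "Polynomial.monom _ _"])
  qed
  also have "\<dots> = (\<Sum>j\<le>n. f (2 * j))"
  proof -
    have "(\<Sum>i\<le>n. f i) = (\<Sum>i\<in>(*) 2 ` {j. 2 * j \<le> n}. f i)"
      by (rule sum.mono_neutral_right) (auto simp: f_def coeff_binomial_square_power elim!: evenE)
    also have "\<dots> = (\<Sum>j\<in>{j. 2 * j \<le> n}. f (2 * j))"
      by (subst sum.reindex) (auto simp: inj_on_def)
    also have "\<dots> = (\<Sum>j\<le>n. f (2 * j))"
    proof (rule sum.mono_neutral_left)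
      have "f (2 * j) = 0" if "\<not> 2 * j \<le> n" for j
        using that by (simp add: f_def binomial_eq_0)
      then show "\<forall>j\<in>{..n} - {j. 2 * j \<le> n}. f (2 * j) = 0" by blast
    qed auto
    finally show ?thesis .
  qed
  finally show ?thesis
    by (simp add: f_def coeff_binomial_square_power mult_ac)
qed

lemma central_trinomial_eq:
  "central_trinomial b c n
    = (\<Sum>j\<le>n. int (n choose (2 * j)) * int ((2 * j) choose j) * b ^ (n - 2 * j) * c ^ j)"
  unfolding central_trinomial_def coeff_trinomial_power_middle by simp

text \<open>The polynomial is e (x^2 + b x + c) + a x. Taking a x from n - k factors leaves the
  coefficient of x^k in the k-th power, which is T_k; this is how the weighted sums of T_k
  arise.\<close>

lemma coeff_trinomial_power_shift:
  "Polynomial.coeff ([:e * c, a + e * b, e:] ^ n) n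
    = (\<Sum>k\<le>n. int (n choose k) * e ^ k * a ^ (n - k) * central_trinomial b c k)"
proof -
  have eq: "[:e * c, a + e * b, e:] = Polynomial.smult e [:c, b, 1:] + Polynomial.monom a 1"
    by (simp add: monom_altdef)
  show ?thesis
    unfolding eq binomial_ring coeff_sum
  proof (intro sum.cong refl)
    fix i assume "i \<in> {..n}"
    then have "Polynomial.coeff (Polynomial.monom (a ^ (n - i)) (n - i) * [:c, b, 1:] ^ i) n = a ^ (n - i) * central_trinomial b c i"
      by (simp add: coeff_monom_mult central_trinomial_def)
    then show "Polynomial.coeff (of_nat (n choose i) * (Polynomial.smult e [:c, b, 1:]) ^ i * Polynomial.monom a 1 ^ (n - i)) n
        = int (n choose i) * e ^ i * a ^ (n - i) * central_trinomial b c i"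
      by (simp add: monom_power mult.assoc of_nat_mult_conv_smult smult_power mult.commute[of _ "Polynomial.monom _ _"]
            del: smult_pCons)
  qed
qed

lemma pcompose_power: "pcompose (f ^ n) g = pcompose f g ^ n"
  by (induction n) (simp_all add: pcompose_mult pcompose_1)

text \<open>Reversing the coefficients of 1 + a x + d x^2 and then substituting d x for x reproduces
  the polynomial times d. Since d is nonzero, the n-th power has degree exactly 2n, which makes 2n
  the centre of the reversal.\<close>

lemma coeff_quadratic_power_reflect:
  fixes a d :: int
  assumes "d \<noteq> 0" "i \<le> 2 * n"
  shows "d ^ i * Polynomial.coeff ([:1, a, d:] ^ n) (2 * n - i) = d ^ n * Polynomial.coeff ([:1, a, d:] ^ n) i"
proof -
  let ?P = "[:1, a, d:]"
  have refl: "reflect_poly ?P = [:d, a, 1:]"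
    using assms by (simp add: reflect_poly_def)
  have deg: "Polynomial.degree (?P ^ n) = 2 * n"
    using assms by (simp add: degree_power_eq)
  have "Polynomial.coeff (reflect_poly (?P ^ n)) i = Polynomial.coeff (?P ^ n) (2 * n - i)"
    using assms by (simp add: coeff_reflect_poly deg)
  moreover have "d ^ i * Polynomial.coeff (reflect_poly (?P ^ n)) i = Polynomial.coeff (pcompose ([:d, a, 1:] ^ n) [:0, d:]) i"
    by (simp only: coeff_pcompose_linear reflect_poly_power refl)
  moreover have "pcompose ([:d, a, 1:] ^ n) [:0, d:] = Polynomial.smult (d ^ n) (?P ^ n)"
  proof -
    have "pcompose [:d, a, 1:] [:0, d:] = Polynomial.smult d ?P"
      by (simp add: pcompose_pCons)
    then show ?thesis by (simp only: pcompose_power smult_power)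
  qed
  ultimately show ?thesis by simp
qed

section \<open>Sums of central trinomial coefficients modulo an odd prime\<close>

locale odd_prime_modulus =
  fixes p :: nat
  assumes prime_p: "prime p" and odd_p: "odd p"
begin

definition n :: nat where "n = (p - 1) div 2"

lemma p_eq: "p = 2 * n + 1"
  using odd_p by (auto simp: n_def elim: oddE)

lemma int_p_eq: "int p = 2 * int n + 1"
  using arg_cong[OF p_eq, of int] by simp

lemma less_p_iff: "k < p \<longleftrightarrow> k \<le> 2 * n"
  using p_eq by linarith

lemma n_pos: "n > 0"
  using prime_gt_1_nat[OF prime_p] p_eq by linarith

lemma coprime_p: "\<not> [u = 0] (mod int p) \<Longrightarrow> coprime u (int p)"
  using prime_p prime_imp_coprime[of "int p" u]
  by (simp add: cong_0_iff coprime_commute)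

lemma cong_cancel:
  "\<not> [u = 0] (mod int p) \<Longrightarrow> [u * x = u * y] (mod int p) \<Longrightarrow> [x = y] (mod int p)"
  using cong_mult_lcancel[OF coprime_p] by blast

lemma cong_mult_0:
  assumes "[u * x = 0] (mod int p)"
  shows "[u = 0] (mod int p) \<or> [x = 0] (mod int p)"
  using assms prime_p by (auto simp: cong_0_iff prime_dvd_mult_iff)

lemma not_cong_0: "0 < k \<Longrightarrow> k < p \<Longrightarrow> \<not> [int k = 0] (mod int p)"
  by (auto simp: cong_0_iff dest: zdvd_imp_le)

lemma not_cong_0_int: "0 < k \<Longrightarrow> k < int p \<Longrightarrow> \<not> [k = 0] (mod int p)"
  by (auto simp: cong_0_iff dest: zdvd_imp_le)

lemma obtain_inverse:
  assumes "\<not> [u = 0] (mod int p)"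
  obtains v where "[u * v = 1] (mod int p)"
  using cong_solve_coprime_int[OF coprime_p[OF assms]] by blast

lemma legendre: "[Legendre u (int p) = u ^ n] (mod int p)"
  unfolding n_def using n_pos
  by (intro euler_criterion prime_p) (simp add: less_p_iff not_le flip: not_less)

lemma legendre_square: "\<not> [u = 0] (mod int p) \<Longrightarrow> Legendre u (int p) ^ 2 = 1"
  by (simp add: Legendre_def)

lemma fermat:
  assumes "\<not> [u = 0] (mod int p)"
  shows "[u ^ (2 * n) = 1] (mod int p)"
  using cong_pow[OF legendre[of u], of 2] legendre_square[OF assms]
  by (simp add: power_mult cong_sym_eq mult.commute flip: power_mult)

lemma four_power: "[4 ^ n = (1 :: int)] (mod int p)"
proof -
  have "\<not> [int 2 = 0] (mod int p)"
    using n_pos by (intro not_cong_0) (auto simp: less_p_iff)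
  from fermat[OF this] show ?thesis by (simp add: power_mult)
qed

section \<open>Binomial and trinomial coefficients modulo p\<close>

lemma minus_half_cong: "[2 * (int n - int k) = - (2 * int k + 1)] (mod int p)"
  by (simp add: int_p_eq cong_iff_dvd_diff algebra_simps)

text \<open>As n is -1/2 modulo p, this mirrors the identity binom(2k, k) = binom(-1/2, k) (-4)^k.
  The induction compares ratios of consecutive terms, with the denominator k + 1 cleared; it is a
  unit because k + 1 < p.\<close>

lemma central_binomial_cong:
  assumes "k < p"
  shows "[int ((2 * k) choose k) = int (n choose k) * (-4) ^ k] (mod int p)"
  using assms
proof (induction k)
  case (Suc k)
  have rec1: "int (k + 1) * int ((2 * Suc k) choose Suc k) = 2 * (2 * int k + 1) * int ((2 * k) choose k)"
  proof -
    have "(2 * Suc k) choose Suc k = 2 * ((2 * k + 1) choose Suc k)"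
      using binomial_symmetric[of k "2 * k + 1"] by simp
    moreover have "Suc k * ((2 * k + 1) choose Suc k) = (2 * k + 1) * ((2 * k) choose k)"
      using Suc_times_binomial[of k "2 * k"] by simp
    ultimately have "Suc k * ((2 * Suc k) choose Suc k) = 2 * (2 * k + 1) * ((2 * k) choose k)"
      by (simp only: mult.left_commute[of _ 2] mult.assoc)
    then have "int (Suc k * ((2 * Suc k) choose Suc k)) = int (2 * (2 * k + 1) * ((2 * k) choose k))"
      by (simp only:)
    then show ?thesis
      by (simp only: of_nat_mult of_nat_add of_nat_numeral of_nat_1 Suc_eq_plus1)
  qed
  have rec2: "int (k + 1) * int (n choose Suc k) = (int n - int k) * int (n choose k)"
  proof (cases "k \<le> n")
    case True
    have "Suc k * (n choose Suc k) = (n - k) * (n choose k)"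
      by (metis binomial_absorption binomial_absorb_comp)
    then have "int (Suc k * (n choose Suc k)) = int ((n - k) * (n choose k))" by simp
    with True show ?thesis by (simp only: of_nat_mult of_nat_diff Suc_eq_plus1)
  qed (simp add: binomial_eq_0)
  have "[2 * (2 * int k + 1) * int ((2 * k) choose k)
        = 2 * (2 * int k + 1) * (int (n choose k) * (-4) ^ k)] (mod int p)"
    using Suc by (intro cong_mult cong_refl) auto
  also have "[2 * (2 * int k + 1) * (int (n choose k) * (-4) ^ k)
        = - 2 * (2 * (int n - int k)) * (int (n choose k) * (-4) ^ k)] (mod int p)"
  proof (rule cong_mult[OF _ cong_refl])
    show "[2 * (2 * int k + 1) = - 2 * (2 * (int n - int k))] (mod int p)"
      using cong_sym[OF cong_scalar_left[OF minus_half_cong, of "-2" k]] by (simp add: add.commute)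
  qed
  also have "- 2 * (2 * (int n - int k)) * (int (n choose k) * (-4) ^ k)
      = (-4) ^ Suc k * ((int n - int k) * int (n choose k))" by (simp add: algebra_simps)
  finally show ?case
    using Suc.prems unfolding rec1[symmetric] rec2[symmetric]
    by - (rule cong_cancel[OF not_cong_0[of "k + 1"]], simp_all add: mult_ac)
qed simp

lemma central_binomial_cong_0:
  assumes "n < k" "k < p"
  shows "[int ((2 * k) choose k) = 0] (mod int p)"
  using central_binomial_cong[OF assms(2)] assms by (simp add: binomial_eq_0)

text \<open>Since 2n - m is -(m + 1) modulo p, this is upper negation of a binomial coefficient. The
  bound on m + i keeps the denominators i + 1 of the induction below p.\<close>

lemma upper_negation_cong:
  assumes "m + i \<le> 2 * n"
  shows "[int ((2 * n - m) choose i) * (-1) ^ i = int ((m + i) choose i)] (mod int p)"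
  using assms
proof (induction i)
  case (Suc i)
  have "Suc i * ((2 * n - m) choose Suc i) = (2 * n - m - i) * ((2 * n - m) choose i)"
    by (metis binomial_absorption binomial_absorb_comp)
  then have "int (Suc i * ((2 * n - m) choose Suc i)) = int ((2 * n - m - i) * ((2 * n - m) choose i))"
    by simp
  then have rec1: "int (i + 1) * int ((2 * n - m) choose Suc i)
      = (2 * int n - int m - int i) * int ((2 * n - m) choose i)"
    using Suc.prems by (simp only: of_nat_mult) (simp add: of_nat_diff)
  have "int (Suc i) * int (Suc (m + i) choose Suc i) = int (Suc (m + i)) * int ((m + i) choose i)"
    by (metis Suc_times_binomial of_nat_mult)
  then have rec2: "int (i + 1) * int ((m + Suc i) choose Suc i)
      = (int m + int i + 1) * int ((m + i) choose i)"
    by (simp add: add_ac del: binomial_Suc_Suc)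
  have "[(int m + int i + 1) * int ((m + i) choose i)
      = - (2 * int n - int m - int i) * (int ((2 * n - m) choose i) * (-1) ^ i)] (mod int p)"
  proof (rule cong_mult)
    show "[int m + int i + 1 = - (2 * int n - int m - int i)] (mod int p)"
      by (simp add: int_p_eq cong_iff_dvd_diff add.commute)
    show "[int ((m + i) choose i) = int ((2 * n - m) choose i) * (-1) ^ i] (mod int p)"
      using Suc by (intro cong_sym[OF Suc.IH]) simp
  qed
  then have "[int (i + 1) * int ((m + Suc i) choose Suc i)
      = int (i + 1) * (int ((2 * n - m) choose Suc i) * (-1) ^ Suc i)] (mod int p)"
    unfolding rec2 mult.assoc[symmetric] rec1 by (simp add: algebra_simps)
  then show ?case
    using Suc.prems by - (rule cong_sym, rule cong_cancel[OF not_cong_0[of "i + 1"]], auto simp: less_p_iff)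
qed simp

text \<open>The generating function of T_k is (1 - 2 b x + (b^2 - 4 c) x^2)^(-1/2), and -1/2 is n
  modulo p. For the proof the quadratic is written as (1 - b x)^2 - 4 c x^2: the powers of -4 c x^2
  supply binom(2j, j) c^j, and those of 1 - b x supply binom(k, 2j) b^(k - 2j) by upper negation
  with m = 2j and i = k - 2j.\<close>

lemma central_trinomial_cong:
  assumes "k \<le> 2 * n"
  shows "[central_trinomial b c k = Polynomial.coeff ([:1, - 2 * b, b ^ 2 - 4 * c:] ^ n) k] (mod int p)"
proof -
  have eq: "[:1, - 2 * b, b ^ 2 - 4 * c:] = Polynomial.monom (- 4 * c) 2 + [:1, - b:] ^ 2"
    by (simp add: monom_altdef numeral_2_eq_2)
  have "Polynomial.coeff ([:1, - 2 * b, b ^ 2 - 4 * c:] ^ n) k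
      = (\<Sum>j\<le>n. if 2 * j \<le> k
          then int (n choose j) * (-4 * c) ^ j * Polynomial.coeff ([:1, - b:] ^ (2 * (n - j))) (k - 2 * j) else 0)"
    unfolding eq binomial_ring coeff_sum
    by (intro sum.cong refl)
      (simp add: monom_power mult.assoc of_nat_mult_conv_smult coeff_monom_mult mult.commute[of _ 2] flip: power_mult)
  also have "\<dots> = (\<Sum>j | 2 * j \<le> k.
       int (n choose j) * (-4 * c) ^ j * Polynomial.coeff ([:1, - b:] ^ (2 * (n - j))) (k - 2 * j))"
    using assms by (intro sum.mono_neutral_cong_right) auto
  finally have coeff_eq: "Polynomial.coeff ([:1, - 2 * b, b ^ 2 - 4 * c:] ^ n) k = \<dots>" .
  have "[(\<Sum>j | 2 * j \<le> k.
       int (n choose j) * (-4 * c) ^ j * Polynomial.coeff ([:1, - b:] ^ (2 * (n - j))) (k - 2 * j))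
     = (\<Sum>j | 2 * j \<le> k. int (k choose (2 * j)) * int ((2 * j) choose j) * b ^ (k - 2 * j) * c ^ j)] (mod int p)"
  proof (intro cong_sum)
    fix j assume "j \<in> {j. 2 * j \<le> k}"
    then have j: "2 * j \<le> k" by simp
    have "2 * (n - j) = 2 * n - 2 * j" by simp
    moreover have "(- b) ^ (k - 2 * j) = (-1) ^ (k - 2 * j) * b ^ (k - 2 * j)"
      by (rule power_minus)
    ultimately have "int (n choose j) * (-4 * c) ^ j * Polynomial.coeff ([:1, - b:] ^ (2 * (n - j))) (k - 2 * j)
       = (int (n choose j) * (-4) ^ j) * (int ((2 * n - 2 * j) choose (k - 2 * j)) * (-1) ^ (k - 2 * j))
          * (b ^ (k - 2 * j) * c ^ j)"
      using assms j power_mult_distrib[of "-4" c j]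
      by (subst coeff_linear_poly_power) auto
    also have "[\<dots> = int ((2 * j) choose j) * int ((2 * j + (k - 2 * j)) choose (k - 2 * j))
          * (b ^ (k - 2 * j) * c ^ j)] (mod int p)"
      using assms j
      by (intro cong_mult cong_refl cong_sym[OF central_binomial_cong] upper_negation_cong) (auto simp: less_p_iff)
    also have "int ((2 * j) choose j) * int ((2 * j + (k - 2 * j)) choose (k - 2 * j)) * (b ^ (k - 2 * j) * c ^ j)
        = int (k choose (2 * j)) * int ((2 * j) choose j) * b ^ (k - 2 * j) * c ^ j"
      using j binomial_symmetric[of "2 * j" k] by simp
    finally show "[int (n choose j) * (-4 * c) ^ j * Polynomial.coeff ([:1, - b:] ^ (2 * (n - j))) (k - 2 * j)
        = int (k choose (2 * j)) * int ((2 * j) choose j) * b ^ (k - 2 * j) * c ^ j] (mod int p)" .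
  qed
  moreover have "(\<Sum>j | 2 * j \<le> k. int (k choose (2 * j)) * int ((2 * j) choose j) * b ^ (k - 2 * j) * c ^ j)
      = central_trinomial b c k"
    unfolding central_trinomial_eq
  proof (rule sum.mono_neutral_left)
    show "\<forall>j\<in>{..k} - {j. 2 * j \<le> k}. int (k choose (2 * j)) * int ((2 * j) choose j) * b ^ (k - 2 * j) * c ^ j = 0"
      by (simp add: binomial_eq_0)
  qed auto
  ultimately have "[Polynomial.coeff ([:1, - 2 * b, b ^ 2 - 4 * c:] ^ n) k = central_trinomial b c k] (mod int p)"
    by (simp only: coeff_eq)
  then show ?thesis by (rule cong_sym)
qed

text \<open>The factor d^n on the right is the origin of d in the Legendre symbol of (3).\<close>

lemma central_trinomial_reflect_cong:
  assumes d: "d = b ^ 2 - 4 * c" "\<not> [d = 0] (mod int p)" and "k \<le> 2 * n"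
  shows "[d ^ k * central_trinomial b c (2 * n - k) = d ^ n * central_trinomial b c k] (mod int p)"
proof -
  have "[d ^ k * central_trinomial b c (2 * n - k)
      = d ^ k * Polynomial.coeff ([:1, - 2 * b, d:] ^ n) (2 * n - k)] (mod int p)"
    unfolding d by (intro cong_mult cong_refl central_trinomial_cong) simp
  also have "d ^ k * Polynomial.coeff ([:1, - 2 * b, d:] ^ n) (2 * n - k)
      = d ^ n * Polynomial.coeff ([:1, - 2 * b, d:] ^ n) k"
    using d assms(3) by (intro coeff_quadratic_power_reflect) auto
  also have "[\<dots> = d ^ n * central_trinomial b c k] (mod int p)"
    unfolding d using assms(3) by (intro cong_mult cong_refl cong_sym[OF central_trinomial_cong])
  finally show ?thesis .
qed

section \<open>Integer versions of the three congruences\<close>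

lemma sum_truncate_cong:
  assumes "\<And>k. n < k \<Longrightarrow> k < p \<Longrightarrow> [f k = 0] (mod int p)"
  shows "[(\<Sum>k=0..p-1. f k) = (\<Sum>k\<le>n. f k)] (mod int p)"
proof -
  have "p - 1 = 2 * n"
    using p_eq by linarith
  then have "{0..p-1} = {..n} \<union> {n<..<p}"
    by (auto simp: less_p_iff)
  then have "(\<Sum>k=0..p-1. f k) = (\<Sum>k\<le>n. f k) + (\<Sum>k\<in>{n<..<p}. f k)"
    by (simp add: sum.union_disjoint ivl_disj_int)
  also have "[\<dots> = (\<Sum>k\<le>n. f k) + (\<Sum>k\<in>{n<..<p}. 0)] (mod int p)"
    using assms by (intro cong_add cong_refl cong_sum) auto
  finally show ?thesis by simp
qed

lemma inverse_power_cong: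
  assumes "[u * v = 1] (mod int p)" "k \<le> l"
  shows "[v ^ l * u ^ k = v ^ (l - k)] (mod int p)"
proof -
  have "v ^ l * u ^ k = v ^ (l - k) * (u * v) ^ k"
    using assms(2) by (simp add: power_mult_distrib mult_ac flip: power_add)
  also have "[\<dots> = v ^ (l - k) * 1 ^ k] (mod int p)"
    using assms(1) by (intro cong_mult cong_refl cong_pow)
  finally show ?thesis by simp
qed

lemma inverse_not_cong_0:
  assumes "[u * v = 1] (mod int p)"
  shows "\<not> [u = 0] (mod int p)" "\<not> [v = 0] (mod int p)"
proof -
  have "\<not> int p dvd 1"
    using prime_p by auto
  moreover have "int p dvd u * v \<longleftrightarrow> int p dvd 1"
    by (rule cong_dvd_iff[OF assms])
  ultimately show "\<not> [u = 0] (mod int p)" "\<not> [v = 0] (mod int p)"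
    by (auto simp: cong_0_iff)
qed

text \<open>A quadratic character does not distinguish a unit from its inverse: u^(2n) = 1.\<close>

lemma inverse_half_power_cong:
  assumes "[u * v = 1] (mod int p)"
  shows "[v ^ n = u ^ n] (mod int p)"
proof -
  have "[v ^ n * 1 = v ^ n * u ^ (2 * n)] (mod int p)"
    using inverse_not_cong_0[OF assms] by (intro cong_mult cong_refl cong_sym[OF fermat])
  also have "v ^ n * u ^ (2 * n) = u ^ n * (v ^ n * u ^ n)"
    by (simp add: mult_2 power_add)
  also have "[\<dots> = u ^ n * v ^ (n - n)] (mod int p)"
    by (intro cong_mult cong_refl inverse_power_cong assms) simp
  finally show ?thesis by simp
qed

text \<open>Pulling out v^n turns v^k into u^(n - k), as \<open>coeff_trinomial_power_shift\<close>
  requires with a = u and e = -4; the -4 comes from \<open>central_binomial_cong\<close>. The shape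
  \<open>u + - 4 * b\<close> is kept to match that lemma.\<close>

lemma binomial_trinomial_sum_cong:
  assumes uv: "[u * v = 1] (mod int p)"
  shows "[(\<Sum>k=0..p-1. int ((2 * k) choose k) * v ^ k * central_trinomial b c k)
     = u ^ n * Polynomial.coeff ([:- 4 * c, u + - 4 * b, - 4:] ^ n) n] (mod int p)"
proof -
  have "[(\<Sum>k=0..p-1. int ((2 * k) choose k) * v ^ k * central_trinomial b c k)
      = (\<Sum>k\<le>n. int ((2 * k) choose k) * v ^ k * central_trinomial b c k)] (mod int p)"
    by (intro sum_truncate_cong) (auto simp: cong_0_iff dest!: central_binomial_cong_0)
  also have "[(\<Sum>k\<le>n. int ((2 * k) choose k) * v ^ k * central_trinomial b c k)
      = (\<Sum>k\<le>n. v ^ n * (int (n choose k) * (-4) ^ k * u ^ (n - k) * central_trinomial b c k))] (mod int p)"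
  proof (intro cong_sum)
    fix k assume "k \<in> {..n}"
    then have k: "k \<le> n" by simp
    have "[int ((2 * k) choose k) * v ^ k * central_trinomial b c k
        = int (n choose k) * (-4) ^ k * (v ^ n * u ^ (n - k)) * central_trinomial b c k] (mod int p)"
      using k cong_sym[OF inverse_power_cong[OF uv, of "n - k" n]]
      by (intro cong_mult cong_refl central_binomial_cong) (auto simp: less_p_iff)
    then show "[int ((2 * k) choose k) * v ^ k * central_trinomial b c k
        = v ^ n * (int (n choose k) * (-4) ^ k * u ^ (n - k) * central_trinomial b c k)] (mod int p)"
      by (simp add: mult_ac)
  qed
  also have "(\<Sum>k\<le>n. v ^ n * (int (n choose k) * (-4) ^ k * u ^ (n - k) * central_trinomial b c k))
      = v ^ n * Polynomial.coeff ([:- 4 * c, u + - 4 * b, - 4:] ^ n) n"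
    unfolding coeff_trinomial_power_shift by (simp add: sum_distrib_left)
  also have "[\<dots> = u ^ n * Polynomial.coeff ([:- 4 * c, u + - 4 * b, - 4:] ^ n) n] (mod int p)"
    by (intro cong_mult cong_refl inverse_half_power_cong uv)
  finally show ?thesis .
qed

lemma binomial_trinomial_sum_degenerate_cong:
  assumes uv: "[u * v = 1] (mod int p)" and "[u = 4 * b] (mod int p)"
  shows "[(\<Sum>k=0..p-1. int ((2 * k) choose k) * v ^ k * central_trinomial b c k)
     = (if even n then Legendre u (int p) * int (n choose (n div 2)) * c ^ (n div 2) else 0)] (mod int p)"
proof -
  have "[u + - 4 * b = 0] (mod int p)"
    using assms(2) by (simp add: cong_iff_dvd_diff)
  then have "[Polynomial.coeff ([:- 4 * c, u + - 4 * b, - 4:] ^ n) n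
      = Polynomial.coeff ([:- 4 * c, 0, - 4:] ^ n) n] (mod int p)"
    unfolding coeff_trinomial_power_middle
    by (intro cong_sum cong_mult cong_pow cong_refl)
  then have "[(\<Sum>k=0..p-1. int ((2 * k) choose k) * v ^ k * central_trinomial b c k)
     = u ^ n * Polynomial.coeff ([:- 4 * c, 0, - 4:] ^ n) n] (mod int p)"
    by (rule cong_trans[OF binomial_trinomial_sum_cong[OF uv] cong_scalar_left])
  also have "[u ^ n * Polynomial.coeff ([:- 4 * c, 0, - 4:] ^ n) n
      = Legendre u (int p) * Polynomial.coeff ([:- 4 * c, 0, - 4:] ^ n) n] (mod int p)"
    by (intro cong_mult cong_refl cong_sym[OF legendre])
  also have "[Legendre u (int p) * Polynomial.coeff ([:- 4 * c, 0, - 4:] ^ n) n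
      = (if even n then Legendre u (int p) * int (n choose (n div 2)) * c ^ (n div 2) else 0)] (mod int p)"
  proof (cases "even n")
    case True
    \<comment> \<open>The middle coefficient contains (-4)(-4c) = 16 c to the power n/2; the surplus
      16^(n/2) is 4^n = 2^(p - 1).\<close>
    have "16 ^ (n div 2) = (4 ^ 2 :: int) ^ (n div 2)" by simp
    also have "\<dots> = 4 ^ n"
      using True by (simp only: power_mult[symmetric] dvd_mult_div_cancel)
    finally have "[16 ^ (n div 2) = (1 :: int)] (mod int p)"
      using four_power by simp
    then have "[Legendre u (int p) * int (n choose (n div 2)) * c ^ (n div 2) * 16 ^ (n div 2)
         = Legendre u (int p) * int (n choose (n div 2)) * c ^ (n div 2) * 1] (mod int p)"
      by (intro cong_mult cong_refl)
    with True show ?thesis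
      by (simp add: coeff_binomial_square_power power_mult_distrib mult_ac)
  qed (simp add: coeff_binomial_square_power)
  finally show ?thesis .
qed

lemma legendre_mult_cong: "[u ^ n * w ^ n = Legendre (u * w) (int p)] (mod int p)"
  using cong_sym[OF legendre[of "u * w"]] by (simp add: power_mult_distrib)

text \<open>Here the linear coefficient a is a unit, so a^n can be pulled out of the trinomial
  expansion, leaving powers of w = 1/a. The product (-4)(-4c) leaves 16^k c^k, and binom(n, 2k) 16^k
  is binom(4k, 2k) modulo p because 2k < p for \<open>k \<le> n\<close>. The symbol collects u^n
  a^n.\<close>

lemma binomial_trinomial_sum_nondegenerate_cong:
  assumes uv: "[u * v = 1] (mod int p)" and aw: "a = u - 4 * b" "[a * w = 1] (mod int p)"
  shows "[(\<Sum>k=0..p-1. int ((2 * k) choose k) * v ^ k * central_trinomial b c k)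
     = Legendre (u * a) (int p) *
       (\<Sum>k=0..p-1. int ((4 * k) choose (2 * k)) * int ((2 * k) choose k) * c ^ k * w ^ (2 * k))] (mod int p)"
proof -
  have "[(\<Sum>k=0..p-1. int ((4 * k) choose (2 * k)) * int ((2 * k) choose k) * c ^ k * w ^ (2 * k))
      = (\<Sum>k\<le>n. int ((4 * k) choose (2 * k)) * int ((2 * k) choose k) * c ^ k * w ^ (2 * k))] (mod int p)"
    by (intro sum_truncate_cong) (auto simp: cong_0_iff dest!: central_binomial_cong_0)
  also have "[(\<Sum>k\<le>n. int ((4 * k) choose (2 * k)) * int ((2 * k) choose k) * c ^ k * w ^ (2 * k))
      = (\<Sum>k\<le>n. int (n choose (2 * k)) * (-4) ^ (2 * k) * int ((2 * k) choose k) * c ^ k * w ^ (2 * k))] (mod int p)"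
  proof (intro cong_sum)
    fix k assume "k \<in> {..n}"
    then have "[int ((4 * k) choose (2 * k)) = int (n choose (2 * k)) * (-4) ^ (2 * k)] (mod int p)"
      using central_binomial_cong[of "2 * k"] by (simp add: less_p_iff)
    then show "[int ((4 * k) choose (2 * k)) * int ((2 * k) choose k) * c ^ k * w ^ (2 * k)
        = int (n choose (2 * k)) * (-4) ^ (2 * k) * int ((2 * k) choose k) * c ^ k * w ^ (2 * k)] (mod int p)"
      by (intro cong_mult cong_refl)
  qed
  finally have "[a ^ n * (\<Sum>k=0..p-1. int ((4 * k) choose (2 * k)) * int ((2 * k) choose k) * c ^ k * w ^ (2 * k))
      = a ^ n * (\<Sum>k\<le>n. int (n choose (2 * k)) * (-4) ^ (2 * k) * int ((2 * k) choose k) * c ^ k * w ^ (2 * k))] (mod int p)"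
    by (rule cong_scalar_left)
  also have "a ^ n * (\<Sum>k\<le>n. int (n choose (2 * k)) * (-4) ^ (2 * k) * int ((2 * k) choose k) * c ^ k * w ^ (2 * k))
      = (\<Sum>k\<le>n. int (n choose (2 * k)) * int ((2 * k) choose k) * (a ^ n * w ^ (2 * k)) * (- 4 * (- 4 * c)) ^ k)"
  proof -
    have "(- 4 * (- 4 * c)) ^ k = (-4) ^ (2 * k) * c ^ k" for k
      by (simp add: power_mult power_mult_distrib)
    then show ?thesis by (simp only: sum_distrib_left mult_ac)
  qed
  also have "[\<dots> = (\<Sum>k\<le>n. int (n choose (2 * k)) * int ((2 * k) choose k) * a ^ (n - 2 * k) * (- 4 * (- 4 * c)) ^ k)] (mod int p)"
  proof (intro cong_sum)
    fix k
    show "[int (n choose (2 * k)) * int ((2 * k) choose k) * (a ^ n * w ^ (2 * k)) * (- 4 * (- 4 * c)) ^ k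
       = int (n choose (2 * k)) * int ((2 * k) choose k) * a ^ (n - 2 * k) * (- 4 * (- 4 * c)) ^ k] (mod int p)"
    \<comment> \<open>For 2k > n the truncated exponent n - 2k is meaningless, but then binom(n, 2k)
      = 0.\<close>
    proof (cases "2 * k \<le> n")
      case True
      then show ?thesis
        using aw(2) by (intro cong_mult cong_refl inverse_power_cong) (auto simp: mult.commute)
    qed (simp add: not_le binomial_eq_0)
  qed
  also have "(\<Sum>k\<le>n. int (n choose (2 * k)) * int ((2 * k) choose k) * a ^ (n - 2 * k) * (- 4 * (- 4 * c)) ^ k)
      = Polynomial.coeff ([:- 4 * c, a, - 4:] ^ n) n"
    unfolding coeff_trinomial_power_middle by simp
  finally have *: "[a ^ n * (\<Sum>k=0..p-1. int ((4 * k) choose (2 * k)) * int ((2 * k) choose k) * c ^ k * w ^ (2 * k))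
      = Polynomial.coeff ([:- 4 * c, u + - 4 * b, - 4:] ^ n) n] (mod int p)"
    by (simp add: aw(1))
  note binomial_trinomial_sum_cong[OF uv, of b c]
  also note cong_scalar_left[OF cong_sym[OF *], of "u ^ n"]
  also have "[u ^ n * (a ^ n * (\<Sum>k=0..p-1. int ((4 * k) choose (2 * k)) * int ((2 * k) choose k) * c ^ k * w ^ (2 * k)))
     = Legendre (u * a) (int p) *
       (\<Sum>k=0..p-1. int ((4 * k) choose (2 * k)) * int ((2 * k) choose k) * c ^ k * w ^ (2 * k))] (mod int p)"
    unfolding mult.assoc[symmetric, of "u ^ n"] by (intro cong_mult cong_refl legendre_mult_cong)
  finally show ?thesis .
qed

text \<open>Up to powers of -4 both sides are binom(n, k), which is symmetric; 16^k = (-4)^(2k)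
  makes up for the difference of the powers.\<close>

lemma central_binomial_reflect_cong:
  assumes "k \<le> n"
  shows "[16 ^ k * int ((2 * (n - k)) choose (n - k)) = (-4) ^ n * int ((2 * k) choose k)] (mod int p)"
proof -
  have "[16 ^ k * int ((2 * (n - k)) choose (n - k)) = 16 ^ k * (int (n choose (n - k)) * (-4) ^ (n - k))] (mod int p)"
    by (intro cong_mult cong_refl central_binomial_cong) (simp add: less_p_iff)
  also have "16 ^ k * (int (n choose (n - k)) * (-4) ^ (n - k)) = (-4) ^ n * (int (n choose k) * (-4) ^ k)"
  proof -
    have "(16 :: int) ^ k = (-4) ^ k * (-4) ^ k"
      by (simp flip: power_mult_distrib)
    moreover have "(-4 :: int) ^ n = (-4) ^ k * (-4) ^ (n - k)"
      using assms by (simp flip: power_add)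
    ultimately show ?thesis
      using binomial_symmetric[OF assms] by (simp only: mult_ac)
  qed
  also have "[\<dots> = (-4) ^ n * int ((2 * k) choose k)] (mod int p)"
    using assms by (intro cong_mult cong_refl cong_sym[OF central_binomial_cong]) (simp add: less_p_iff)
  finally show ?thesis .
qed

lemma binomial_power_trinomial_sum_cong:
  assumes uv: "[u * v = 1] (mod int p)"
    and d: "d = b ^ 2 - 4 * c" "\<not> [d = 0] (mod int p)"
    and w: "[16 ^ h * d ^ 2 * w = u] (mod int p)" and "h > 0"
  shows "[(\<Sum>k=0..p-1. int ((2 * k) choose k) ^ h * central_trinomial b c (2 * k) * v ^ k)
    = Legendre ((-1) ^ h * d * u) (int p) *
      (\<Sum>k=0..p-1. int ((2 * k) choose k) ^ h * central_trinomial b c (2 * k) * w ^ k)] (mod int p)"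
proof -
  define x where "x k = int ((2 * k) choose k) ^ h * central_trinomial b c (2 * k)" for k
  define L where "L = Legendre ((-1) ^ h * d * u) (int p)"
  \<comment> \<open>The vanishing for n < k comes from binom(2k, k)^h, hence from h > 0.\<close>
  have trunc: "[(\<Sum>k=0..p-1. x k * z ^ k) = (\<Sum>k\<le>n. x k * z ^ k)] (mod int p)" for z
    using \<open>h > 0\<close> by (intro sum_truncate_cong)
      (auto simp: x_def cong_0_iff dest!: central_binomial_cong_0 intro!: dvd_mult2 dvd_trans[OF _ dvd_power])
  have "\<not> [int 2 = 0] (mod int p)"
    using n_pos by (intro not_cong_0) (auto simp: less_p_iff)
  then have "coprime 2 (int p)"
    using coprime_p by force
  then have "coprime ((2 ^ 4) ^ h * d ^ 2) (int p)"
    using coprime_p[OF d(2)] by (simp only: coprime_mult_left_iff coprime_power_left_iff simp_thms)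
  then have cop: "coprime ((16 ^ h * d ^ 2) ^ k) (int p)" for k
    by simp
  \<comment> \<open>The reflections produce (-4)^(n h) from the binomials, d^n from T and u^n from
    v^n. As 4^n = 1, only the sign (-1)^h survives inside the symbol.\<close>
  have L: "[((-4) ^ h * d * u) ^ n = L] (mod int p)"
  proof -
    have "((-4) ^ h * d * u) ^ n = (4 ^ n) ^ h * ((-1) ^ h * d * u) ^ n"
      by (subst power_minus) (simp add: power_mult_distrib mult_ac flip: power_mult)
    also have "[\<dots> = 1 ^ h * L] (mod int p)"
      unfolding L_def by (intro cong_mult cong_pow four_power cong_sym[OF legendre])
    finally show ?thesis by simp
  qed
  \<comment> \<open>Multiplication by (16^h d^2)^k gives each of the h binomial factors its 16^k and
    the trinomial coefficient of index 2n - 2k its d^(2k), as the two reflection lemmas demand; the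
    unit is cancelled at the end.\<close>
  have key: "[x (n - k) * v ^ (n - k) = L * (x k * w ^ k)] (mod int p)" if k: "k \<le> n" for k
  proof -
    have "(16 ^ h * d ^ 2) ^ k * (x (n - k) * v ^ (n - k))
        = (16 ^ k * int ((2 * (n - k)) choose (n - k))) ^ h
          * (d ^ (2 * k) * central_trinomial b c (2 * n - 2 * k)) * v ^ (n - k)"
      by (simp add: x_def power_mult_distrib diff_mult_distrib2 mult_ac flip: power_mult)
    also have "[\<dots> = ((-4) ^ n * int ((2 * k) choose k)) ^ h
          * (d ^ n * central_trinomial b c (2 * k)) * (v ^ n * u ^ k)] (mod int p)"
      using k by (intro cong_mult cong_pow central_binomial_reflect_cong central_trinomial_reflect_cong[OF d]
          cong_sym[OF inverse_power_cong[OF uv]]) auto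
    also have "[((-4) ^ n * int ((2 * k) choose k)) ^ h
          * (d ^ n * central_trinomial b c (2 * k)) * (v ^ n * u ^ k)
        = ((-4) ^ n * int ((2 * k) choose k)) ^ h
          * (d ^ n * central_trinomial b c (2 * k)) * (u ^ n * (16 ^ h * d ^ 2 * w) ^ k)] (mod int p)"
      by (intro cong_mult cong_refl cong_pow inverse_half_power_cong uv cong_sym[OF w])
    also have "((-4) ^ n * int ((2 * k) choose k)) ^ h
          * (d ^ n * central_trinomial b c (2 * k)) * (u ^ n * (16 ^ h * d ^ 2 * w) ^ k)
        = ((-4) ^ h * d * u) ^ n * ((16 ^ h * d ^ 2) ^ k * (x k * w ^ k))"
      by (simp add: x_def power_mult_distrib mult_ac flip: power_mult)
    also have "[\<dots> = L * ((16 ^ h * d ^ 2) ^ k * (x k * w ^ k))] (mod int p)"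
      by (intro cong_mult cong_refl L)
    also have "L * ((16 ^ h * d ^ 2) ^ k * (x k * w ^ k)) = (16 ^ h * d ^ 2) ^ k * (L * (x k * w ^ k))"
      by simp
    finally show ?thesis
      using cong_mult_lcancel[OF cop] by blast
  qed
  have "[(\<Sum>k=0..p-1. x k * v ^ k) = (\<Sum>k\<le>n. x k * v ^ k)] (mod int p)"
    by (rule trunc)
  also have "(\<Sum>k\<le>n. x k * v ^ k) = (\<Sum>k\<le>n. x (n - k) * v ^ (n - k))"
    by (rule sum.reindex_bij_witness[where i = "\<lambda>k. n - k" and j = "\<lambda>k. n - k"]) auto
  also have "[\<dots> = (\<Sum>k\<le>n. L * (x k * w ^ k))] (mod int p)"
    by (intro cong_sum key) simp
  also have "(\<Sum>k\<le>n. L * (x k * w ^ k)) = L * (\<Sum>k\<le>n. x k * w ^ k)"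
    by (simp add: sum_distrib_left)
  also have "[\<dots> = L * (\<Sum>k=0..p-1. x k * w ^ k)] (mod int p)"
    by (intro cong_mult cong_refl cong_sym[OF trunc])
  finally show ?thesis unfolding x_def L_def .
qed

end

section \<open>Jacobsthal sums\<close>

text \<open>The linear order serves to pick one element from each pair x, g x.\<close>

lemma even_card_involution:
  fixes g :: "'a :: linorder \<Rightarrow> 'a"
  assumes "finite A" and g: "\<And>x. x \<in> A \<Longrightarrow> g x \<in> A \<and> g (g x) = x \<and> g x \<noteq> x"
  shows "even (card A)"
proof -
  let ?L = "{x \<in> A. x < g x}" and ?U = "{x \<in> A. g x < x}"
  have "bij_betw g ?L ?U"
    using g by (intro bij_betwI[where g = g]) auto
  then have "card ?L = card ?U" by (rule bij_betw_same_card)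
  moreover have "card (?L \<union> ?U) = card ?L + card ?U"
    using assms(1) by (intro card_Un_disjoint) auto
  moreover have "?L \<union> ?U = A"
    using g by (auto simp: neq_iff)
  ultimately show ?thesis by simp
qed

text \<open>The product of X y - x Y and X y + x Y is p (X^2 - x^2), so p divides one factor;
  replacing Y by -Y exchanges them. The residue of x and X modulo 4 then decides the sign.\<close>

lemma prime_sum_two_squares_unique:
  fixes x y X Y :: int
  assumes p: "prime p" and xy: "p = x ^ 2 + y ^ 2" and XY: "p = X ^ 2 + Y ^ 2"
    and x: "[x = 1] (mod 4)" and X: "[X = 1] (mod 4)"
  shows "X = x"
proof -
  have eq_if_square: "X = x" if "X ^ 2 = x ^ 2"
  proof -
    have "X \<noteq> - x"
      using x X unfolding cong_iff_dvd_diff by presburger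
    then show ?thesis using that by (simp add: power2_eq_iff)
  qed
  have main: "X = x" if "p dvd X * y - x * Y" and Y: "p = X ^ 2 + Y ^ 2" for Y
  proof -
    obtain k where k: "X * y - x * Y = p * k"
      using \<open>p dvd X * y - x * Y\<close> by blast
    \<comment> \<open>Brahmagupta's identity: the left side equals p^2, which leaves k^2 = 0 or k^2
      = 1.\<close>
    have "(X * x + Y * y) ^ 2 + (p * k) ^ 2 = (X ^ 2 + Y ^ 2) * (x ^ 2 + y ^ 2)"
      unfolding k[symmetric] by (simp add: power2_eq_square algebra_simps)
    then have norm: "(X * x + Y * y) ^ 2 + p ^ 2 * k ^ 2 = p ^ 2"
      using xy Y by (simp add: power2_eq_square power_mult_distrib mult_ac)
    have "p > 0" using p prime_gt_0_int by blast
    then have "p ^ 2 > 0" by simp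
    moreover have "p ^ 2 * k ^ 2 \<le> p ^ 2 * 1"
      using norm zero_le_power2[of "X * x + Y * y"] by linarith
    ultimately have "k ^ 2 \<le> 1"
      using mult_le_cancel_left_pos by blast
    then have "k ^ 2 = 0 \<or> k ^ 2 = 1"
      using zero_le_power2[of k] by linarith
    then show "X = x"
    proof
      assume "k ^ 2 = 0"
      then have "X * y = x * Y" using k by simp
      then have "X ^ 2 * y ^ 2 = x ^ 2 * Y ^ 2"
        by (metis power_mult_distrib)
      then have "X ^ 2 * (p - x ^ 2) = x ^ 2 * (p - X ^ 2)"
        using xy Y by (metis add_diff_cancel_left')
      then have "p * (X ^ 2 - x ^ 2) = 0"
        by (simp add: algebra_simps)
      then show ?thesis
        using \<open>p > 0\<close> eq_if_square by auto
    next
      assume "k ^ 2 = 1"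
      \<comment> \<open>As x and X are odd, y and Y are odd as well, so p is even; for p = 2 all
        four squares are 1.\<close>
      then have "X * x + Y * y = 0" using norm by simp
      moreover have "odd x" "odd X"
        using x X unfolding cong_def by presburger+
      ultimately have "odd y" "odd Y"
        by (metis even_add even_mult_iff even_zero)+
      then have "even p" "odd x" "odd y"
        using xy \<open>odd x\<close> by auto
      then have "p = 2"
        using prime_ge_2_int[OF p] prime_odd_int[OF p] by fastforce
      have "x ^ 2 \<ge> 1" "y ^ 2 \<ge> 1" "X ^ 2 \<ge> 1" "Y ^ 2 \<ge> 1"
        using \<open>odd x\<close> \<open>odd y\<close> \<open>odd X\<close> \<open>odd Y\<close> by (auto simp: int_one_le_iff_zero_less)
      then have "X ^ 2 = x ^ 2"
        using \<open>p = 2\<close> xy Y by linarith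
      then show ?thesis by (rule eq_if_square)
    qed
  qed
  have "(X * y - x * Y) * (X * y - x * (- Y)) = p * (X ^ 2 - x ^ 2)"
  proof -
    have "(X * y - x * Y) * (X * y - x * (- Y)) = X ^ 2 * y ^ 2 - x ^ 2 * Y ^ 2"
      by (simp add: power2_eq_square algebra_simps)
    also have "\<dots> = X ^ 2 * (p - x ^ 2) - x ^ 2 * (p - X ^ 2)"
      using xy XY by (metis add_diff_cancel_left')
    finally show ?thesis by (simp add: algebra_simps)
  qed
  then have "p dvd X * y - x * Y \<or> p dvd X * y - x * (- Y)"
    using p by (metis dvd_triv_left prime_dvd_mult_iff)
  then show ?thesis
    using main[of Y] main[of "- Y"] XY by auto
qed

section \<open>The Legendre symbol as a character modulo p\<close>

context odd_prime_modulus
begin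

abbreviation \<chi> :: "int \<Rightarrow> int" where "\<chi> t \<equiv> Legendre t (int p)"

lemma p_ge_3: "int p \<ge> 3"
  using int_p_eq n_pos by linarith

text \<open>Exact values of symbols and of complete character sums are obtained below from a
  congruence modulo p together with a bound on the size.\<close>

lemma cong_small_eq:
  assumes "[x = y] (mod int p)" "\<bar>x - y\<bar> < int p"
  shows "x = y"
  using assms zdvd_imp_le[of "int p" "\<bar>x - y\<bar>"] by (force simp: cong_iff_dvd_diff)

lemma legendre_values: "\<chi> t = 0 \<or> \<chi> t = 1 \<or> \<chi> t = -1"
  by (auto simp: Legendre_def)

lemma legendre_0_iff: "\<chi> t = 0 \<longleftrightarrow> [t = 0] (mod int p)"
  by (auto simp: Legendre_def)

lemma legendre_eqI:
  assumes "[t ^ n = s] (mod int p)" "s = 0 \<or> s = 1 \<or> s = -1"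
  shows "\<chi> t = s"
  using cong_trans[OF legendre assms(1)] assms(2) legendre_values[of t] p_ge_3
  by (intro cong_small_eq) auto

lemma legendre_cong: "[s = t] (mod int p) \<Longrightarrow> \<chi> s = \<chi> t"
  by (intro legendre_eqI cong_trans[OF cong_pow cong_sym[OF legendre]] legendre_values)

lemma legendre_mult: "\<chi> (s * t) = \<chi> s * \<chi> t"
proof (rule legendre_eqI)
  show "[(s * t) ^ n = \<chi> s * \<chi> t] (mod int p)"
    unfolding power_mult_distrib by (intro cong_mult cong_sym[OF legendre])
qed (use legendre_values[of s] legendre_values[of t] in auto)

lemma legendre_1 [simp]: "\<chi> 1 = 1"
  by (rule legendre_eqI) auto

lemma legendre_0 [simp]: "\<chi> 0 = 0"
  by (simp add: legendre_0_iff)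

lemma legendre_self_mult: "\<not> [t = 0] (mod int p) \<Longrightarrow> \<chi> t * \<chi> t = 1"
  using legendre_square by (simp add: power2_eq_square)

lemma legendre_abs_le: "\<bar>\<chi> t\<bar> \<le> 1"
  using legendre_values[of t] by auto

section \<open>Power sums and complete character sums\<close>

lemma residue_0_iff: "t \<in> {0..<int p} \<Longrightarrow> [t = 0] (mod int p) \<longleftrightarrow> t = 0"
  using cong_small_eq[of t 0] by auto

text \<open>Telescoping (t + 1)^(k + 1) - t^(k + 1) over t < p expresses p^(k + 1) through the power
  sums of exponent at most k. The last one has coefficient k + 1, a unit since k + 1 < p.\<close>

lemma power_sum_cong_0:
  "k < 2 * n \<Longrightarrow> [(\<Sum>t\<in>{0..<int p}. t ^ k) = 0] (mod int p)"
proof (induction k rule: less_induct)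
  case (less k)
  define P where "P k = (\<Sum>t<p. int t ^ k)" for k
  have P: "(\<Sum>t\<in>{0..<int p}. t ^ k) = P k" for k
    unfolding P_def lessThan_atLeast0 image_int_atLeastLessThan[symmetric, of 0 p, simplified]
    by (simp add: sum.reindex)
  have "int p ^ Suc k = (\<Sum>t<p. int (Suc t) ^ Suc k - int t ^ Suc k)"
    by (subst sum_lessThan_telescope) simp
  also have "\<dots> = (\<Sum>t<p. \<Sum>i\<le>k. int (Suc k choose i) * int t ^ i)"
  proof (intro sum.cong refl)
    fix t
    have "int (Suc t) ^ Suc k = (\<Sum>i\<le>Suc k. int (Suc k choose i) * int t ^ i)"
      using binomial_ring[of "int t" 1 "Suc k"] by (simp add: add.commute del: binomial_Suc_Suc power_Suc)
    then show "int (Suc t) ^ Suc k - int t ^ Suc k = (\<Sum>i\<le>k. int (Suc k choose i) * int t ^ i)"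
      by (simp del: binomial_Suc_Suc)
  qed
  also have "\<dots> = (\<Sum>i\<le>k. int (Suc k choose i) * P i)"
    unfolding P_def sum_distrib_left by (rule sum.swap)
  also have "\<dots> = (\<Sum>i<k. int (Suc k choose i) * P i) + int (Suc k) * P k"
    by (simp add: lessThan_Suc_atMost[symmetric] del: binomial_Suc_Suc) 
  finally have "int (Suc k) * P k = int p ^ Suc k - (\<Sum>i<k. int (Suc k choose i) * P i)"
    by simp
  also have "[\<dots> = 0 - (\<Sum>i<k. int (Suc k choose i) * 0)] (mod int p)"
    using less unfolding P by (intro cong_diff cong_sum cong_mult cong_refl) (auto simp: cong_0_iff)
  finally have "[int (Suc k) * P k = int (Suc k) * 0] (mod int p)" by simp
  then show ?case
    unfolding P using less.prems by - (rule cong_cancel[OF not_cong_0[of "Suc k"]], auto simp: less_p_iff)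
qed

lemma residue_split: "{0..<int p} = insert 0 {1..<int p}"
  using p_ge_3 by auto

lemma power_sum_period:
  assumes "k > 0"
  shows "[(\<Sum>t\<in>{0..<int p}. t ^ (2 * n + k)) = (\<Sum>t\<in>{0..<int p}. t ^ k)] (mod int p)"
proof (intro cong_sum)
  fix t assume t: "t \<in> {0..<int p}"
  show "[t ^ (2 * n + k) = t ^ k] (mod int p)"
  proof (cases "t = 0")
    case False
    then have "[t ^ (2 * n) * t ^ k = 1 * t ^ k] (mod int p)"
      using t by (intro cong_mult cong_refl fermat) (simp add: residue_0_iff)
    then show ?thesis by (simp add: power_add)
  qed (use assms in \<open>simp add: power_0_left\<close>)
qed

lemma power_sum_top: "[(\<Sum>t\<in>{0..<int p}. t ^ (2 * n)) = -1] (mod int p)"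
proof -
  have "(\<Sum>t\<in>{0..<int p}. t ^ (2 * n)) = (\<Sum>t\<in>{1..<int p}. t ^ (2 * n))"
    using n_pos by (simp add: residue_split)
  also have "[\<dots> = (\<Sum>t\<in>{1..<int p}. 1)] (mod int p)"
    by (intro cong_sum fermat) (auto simp: residue_0_iff)
  also have "[(\<Sum>t\<in>{1..<int p}. 1) = -1] (mod int p)"
    using p_ge_3 by (simp add: cong_iff_dvd_diff)
  finally show ?thesis .
qed

text \<open>Only exponents that are positive multiples of p - 1 = 2n contribute, and below 4n the
  only one is 2n.\<close>

lemma poly_sum_cong:
  fixes f :: "int poly"
  assumes "Polynomial.degree f < 4 * n"
  shows "[(\<Sum>t\<in>{0..<int p}. poly f t) = - Polynomial.coeff f (2 * n)] (mod int p)"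
proof -
  have "(\<Sum>t\<in>{0..<int p}. poly f t) = (\<Sum>t\<in>{0..<int p}. \<Sum>i<4 * n. Polynomial.coeff f i * t ^ i)"
    unfolding poly_altdef using assms
    by (intro sum.cong refl sum.mono_neutral_left) (auto simp: coeff_eq_0)
  also have "\<dots> = (\<Sum>i<4 * n. Polynomial.coeff f i * (\<Sum>t\<in>{0..<int p}. t ^ i))"
    unfolding sum_distrib_left by (rule sum.swap)
  also have "[\<dots> = (\<Sum>i<4 * n. Polynomial.coeff f i * (if i = 2 * n then -1 else 0))] (mod int p)"
  proof (intro cong_sum cong_mult cong_refl)
    fix i assume i: "i \<in> {..<4 * n}"
    consider "i < 2 * n" | "i = 2 * n" | k where "i = 2 * n + k" "0 < k" "k < 2 * n"
    proof -
      assume *: "i < 2 * n \<Longrightarrow> thesis" "i = 2 * n \<Longrightarrow> thesis"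
        "\<And>k. i = 2 * n + k \<Longrightarrow> 0 < k \<Longrightarrow> k < 2 * n \<Longrightarrow> thesis"
      show thesis
        using *(1,2) *(3)[of "i - 2 * n"] i by fastforce
    qed
    then show "[(\<Sum>t\<in>{0..<int p}. t ^ i) = (if i = 2 * n then -1 else 0)] (mod int p)"
    proof cases
      case 1
      then show ?thesis using power_sum_cong_0 by simp
    next
      case 2
      then show ?thesis using power_sum_top by simp
    next
      case (3 k)
      then show ?thesis
        using cong_trans[OF power_sum_period power_sum_cong_0, of k] by simp
    qed
  qed
  also have "(\<Sum>i<4 * n. Polynomial.coeff f i * (if i = 2 * n then -1 else 0)) = - Polynomial.coeff f (2 * n)"
    using n_pos by (simp add: if_distrib sum.delta cong: if_cong)
  finally show ?thesis .
qed

text \<open>Euler's criterion replaces the symbol by the n-th power. The bound amounts to degree at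
  most 3, enough for the cubics of the Jacobsthal sums.\<close>

lemma legendre_poly_sum_cong:
  assumes "Polynomial.degree g * n < 4 * n"
  shows "[(\<Sum>t\<in>{0..<int p}. \<chi> (poly g t)) = - Polynomial.coeff (g ^ n) (2 * n)] (mod int p)"
proof -
  have "[(\<Sum>t\<in>{0..<int p}. \<chi> (poly g t)) = (\<Sum>t\<in>{0..<int p}. poly (g ^ n) t)] (mod int p)"
    unfolding poly_power by (intro cong_sum legendre)
  moreover have "Polynomial.degree (g ^ n) < 4 * n"
    using degree_power_le[of g n] assms by (rule le_less_trans)
  ultimately show ?thesis
    using cong_trans poly_sum_cong by blast
qed

lemma sum_legendre: "(\<Sum>t\<in>{0..<int p}. \<chi> t) = 0"
proof (rule cong_small_eq)
  have "[(\<Sum>t\<in>{0..<int p}. \<chi> (poly [:0, 1:] t)) = - Polynomial.coeff ([:0, 1:] ^ n) (2 * n)] (mod int p)"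
    using n_pos by (intro legendre_poly_sum_cong) simp
  moreover have "Polynomial.coeff ([:0, 1::int:] ^ n) (2 * n) = 0"
    using n_pos by (simp add: coeff_eq_0 degree_power_eq)
  ultimately show "[(\<Sum>t\<in>{0..<int p}. \<chi> t) = 0] (mod int p)"
    by simp
  have "\<bar>\<Sum>t\<in>{1..<int p}. \<chi> t\<bar> \<le> (\<Sum>t\<in>{1..<int p}. 1)"
    by (rule order_trans[OF sum_abs sum_mono]) (rule legendre_abs_le)
  then show "\<bar>(\<Sum>t\<in>{0..<int p}. \<chi> t) - 0\<bar> < int p"
    using p_ge_3 by (simp add: residue_split)
qed

text \<open>The leading coefficient 1 makes the sum -1 modulo p; size fixes it. If u and v agree
  modulo p, all terms are nonnegative and one is 0, so the sum lies between 0 and p - 1. Otherwise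
  two terms vanish, and its absolute value is at most p - 2.\<close>

lemma sum_legendre_quadratic:
  "(\<Sum>a\<in>{0..<int p}. \<chi> ((a + u) * (a + v))) = (if [u = v] (mod int p) then int p else 0) - 1"
proof (rule cong_small_eq)
  let ?f = "\<lambda>a. \<chi> ((a + u) * (a + v))"
  let ?S = "\<Sum>a\<in>{0..<int p}. ?f a"
  define g where "g = [:u * v, u + v, 1:]"
  have "[(\<Sum>a\<in>{0..<int p}. \<chi> (poly g a)) = - Polynomial.coeff (g ^ n) (2 * n)] (mod int p)"
    using n_pos by (intro legendre_poly_sum_cong) (simp add: g_def)
  moreover have "poly g a = (a + u) * (a + v)" for a
    by (simp add: g_def algebra_simps)
  moreover have "Polynomial.coeff (g ^ n) (2 * n) = 1"
  proof -
    have deg: "Polynomial.degree (g ^ n) = 2 * n"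
      by (simp add: g_def degree_power_eq)
    have "lead_coeff (g ^ n) = 1"
      by (simp add: g_def lead_coeff_power)
    then show ?thesis unfolding deg .
  qed
  ultimately have S: "[?S = -1] (mod int p)" by simp
  have "[(if [u = v] (mod int p) then int p else 0) = 0] (mod int p)"
    by (simp add: cong_0_iff)
  from cong_sym[OF cong_diff[OF this cong_refl]]
  have "[0 - 1 = (if [u = v] (mod int p) then int p else 0) - 1] (mod int p)" .
  with S show "[?S = (if [u = v] (mod int p) then int p else 0) - 1] (mod int p)"
    using cong_trans by fastforce
  \<comment> \<open>The roots of the quadratic, as elements of the residue system.\<close>
  define z where "z w = (- w) mod int p" for w
  have z: "z w \<in> {0..<int p}" "[z w + w = 0] (mod int p)" for w
    using p_ge_3 by (auto simp: z_def cong_def mod_simps)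
  have f_z: "?f (z u) = 0" "?f (z v) = 0"
    using cong_mult[OF z(2)[of u] cong_refl] cong_mult[OF cong_refl z(2)[of v]] by (auto simp: legendre_0_iff)
  show "\<bar>?S - ((if [u = v] (mod int p) then int p else 0) - 1)\<bar> < int p"
  proof (cases "[u = v] (mod int p)")
    case True
    have nonneg: "?f a \<ge> 0" for a
    proof -
      have "?f a = \<chi> (a + u) * \<chi> (a + u)"
        using legendre_cong[of "a + u" "a + v"] cong_add[OF cong_refl True] by (simp add: legendre_mult)
      then show ?thesis by simp
    qed
    have "?S = (\<Sum>a\<in>{0..<int p} - {z u}. ?f a)"
      using z[of u] f_z by (subst sum.remove[of _ "z u"]) auto
    also have "\<dots> \<le> (\<Sum>a\<in>{0..<int p} - {z u}. 1)"
      by (intro sum_mono) (use legendre_abs_le in \<open>auto simp: abs_le_iff\<close>)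
    also have "\<dots> = int p - 1"
      using z[of u] p_ge_3 by (simp add: card_Diff_singleton)
    finally have "?S \<le> int p - 1" .
    moreover have "?S \<ge> 0" by (intro sum_nonneg nonneg)
    ultimately show ?thesis using True p_ge_3 by simp
  next
    case False
    have "z u \<noteq> z v"
    proof
      assume "z u = z v"
      then have "[z u + u = z u + v] (mod int p)"
        using cong_trans[OF z(2)[of u] cong_sym[OF z(2)[of v]]] by simp
      with False show False by (simp add: cong_add_lcancel)
    qed
    have "?S = (\<Sum>a\<in>{0..<int p} - {z u, z v}. ?f a)"
      using z[of u] z[of v] f_z by (intro sum.mono_neutral_right) auto
    also have "\<bar>\<dots>\<bar> \<le> (\<Sum>a\<in>{0..<int p} - {z u, z v}. 1)"
      by (rule order_trans[OF sum_abs sum_mono]) (rule legendre_abs_le)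
    also have "\<dots> = int p - 2"
      using z[of u] z[of v] \<open>z u \<noteq> z v\<close> p_ge_3 by (simp add: card_Diff_subset of_nat_diff)
    finally show ?thesis using False by simp
  qed
qed

section \<open>Jacobsthal sums and their second moment\<close>

lemma sum_residues_scale:
  fixes f :: "int \<Rightarrow> int"
  assumes k: "\<not> [k = 0] (mod int p)" and f: "\<And>s t. [s = t] (mod int p) \<Longrightarrow> f s = f t"
  shows "(\<Sum>t\<in>{0..<int p}. f (k * t)) = (\<Sum>t\<in>{0..<int p}. f t)"
proof -
  have "(\<Sum>t\<in>{1..<int p}. f (k * t)) = (\<Sum>t\<in>{1..<int p}. f (k * t mod int p))"
    by (intro sum.cong refl f) (simp add: cong_def)
  also have "\<dots> = (\<Sum>t\<in>{1..<int p}. f t)"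
    by (rule sum.reindex_bij_betw[OF bij_betw_int_remainders_mult[OF coprime_p[OF k]]])
  finally show ?thesis by (simp add: residue_split)
qed

text \<open>For a prime to p this is minus the trace of Frobenius of the elliptic curve y^2 = t^3 +
  a t.\<close>

definition jacobsthal :: "int \<Rightarrow> int" where
  "jacobsthal a = (\<Sum>t\<in>{0..<int p}. \<chi> (t * (t ^ 2 + a)))"

lemma jacobsthal_cong: "[a = b] (mod int p) \<Longrightarrow> jacobsthal a = jacobsthal b"
  unfolding jacobsthal_def by (intro sum.cong refl legendre_cong cong_mult cong_add cong_refl)

text \<open>Substituting k t for t pulls out k^3, whose symbol is that of k.\<close>

lemma jacobsthal_scale:
  assumes "\<not> [k = 0] (mod int p)"
  shows "jacobsthal (a * k ^ 2) = \<chi> k * jacobsthal a"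
proof -
  have "jacobsthal (a * k ^ 2) = (\<Sum>t\<in>{0..<int p}. \<chi> (k * t * ((k * t) ^ 2 + a * k ^ 2)))"
    unfolding jacobsthal_def
    by (rule sum_residues_scale[OF assms, symmetric]) (intro legendre_cong cong_mult cong_add cong_pow cong_refl)
  also have "\<dots> = (\<Sum>t\<in>{0..<int p}. \<chi> k * \<chi> (t * (t ^ 2 + a)))"
  proof (intro sum.cong refl)
    fix t
    have "k * t * ((k * t) ^ 2 + a * k ^ 2) = k * k * (k * (t * (t ^ 2 + a)))"
      by (simp add: power2_eq_square algebra_simps)
    then show "\<chi> (k * t * ((k * t) ^ 2 + a * k ^ 2)) = \<chi> k * \<chi> (t * (t ^ 2 + a))"
      by (simp only: legendre_mult legendre_self_mult[OF assms] mult_1)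
  qed
  finally show ?thesis by (simp add: jacobsthal_def sum_distrib_left)
qed

lemma legendre_eq_1_iff: "\<chi> a = 1 \<longleftrightarrow> \<not> [a = 0] (mod int p) \<and> (\<exists>k. [k ^ 2 = a] (mod int p))"
  by (auto simp: Legendre_def QuadRes_def)

text \<open>If a b = k^2 modulo p, then a b^2 = b k^2; scaling by b on one side and by k on the
  other costs only signs, which squaring removes.\<close>

lemma jacobsthal_square_eq:
  assumes "\<chi> a = \<chi> b" "\<not> [b = 0] (mod int p)"
  shows "jacobsthal a ^ 2 = jacobsthal b ^ 2"
proof -
  have sq: "(\<chi> k * z) ^ 2 = z ^ 2" if "\<not> [k = 0] (mod int p)" for k z
    using legendre_square[OF that] by (simp add: power_mult_distrib)
  have "\<chi> (a * b) = 1"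
    using assms by (simp add: legendre_mult legendre_self_mult)
  then obtain k where k: "[k ^ 2 = a * b] (mod int p)" and ab: "\<not> [a * b = 0] (mod int p)"
    unfolding legendre_eq_1_iff by blast
  have k0: "\<not> [k = 0] (mod int p)"
    using ab cong_trans[OF cong_sym[OF k]] cong_pow[of k 0 "int p" 2] by auto
  have "jacobsthal a ^ 2 = jacobsthal (a * b ^ 2) ^ 2"
    by (simp add: jacobsthal_scale[OF assms(2)] sq[OF assms(2)])
  also have "jacobsthal (a * b ^ 2) = jacobsthal (b * k ^ 2)"
    using cong_mult[OF cong_refl[of b] cong_sym[OF k]]
    by (intro jacobsthal_cong) (simp add: power2_eq_square mult_ac)
  also have "\<dots> ^ 2 = jacobsthal b ^ 2"
    by (simp add: jacobsthal_scale[OF k0] sq[OF k0])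
  finally show ?thesis .
qed

text \<open>In t^n (t^2 + 1)^n the coefficient of t^(2n) is the middle coefficient of the second
  factor.\<close>

lemma jacobsthal_1_cong:
  assumes "even n"
  shows "[jacobsthal 1 = - int (n choose (n div 2))] (mod int p)"
proof -
  let ?g = "[:0, 1:] * [:1, 0, 1::int:]"
  have sum: "[(\<Sum>t\<in>{0..<int p}. \<chi> (poly ?g t)) = - Polynomial.coeff (?g ^ n) (2 * n)] (mod int p)"
    using n_pos by (intro legendre_poly_sum_cong) simp
  have poly: "poly ?g t = t * (t ^ 2 + 1)" for t
    by (simp add: power2_eq_square)
  have coeff: "Polynomial.coeff (?g ^ n) (2 * n) = int (n choose (n div 2))"
  proof -
    have "?g ^ n = Polynomial.monom 1 n * [:1, 0, 1:] ^ n"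
      unfolding power_mult_distrib by (simp add: monom_altdef)
    then show ?thesis
      using assms by (simp add: coeff_monom_mult coeff_binomial_square_power)
  qed
  show ?thesis
    using sum by (simp only: jacobsthal_def poly coeff)
qed

lemma jacobsthal_0: "jacobsthal 0 = 0"
proof -
  have "\<chi> (t * (t ^ 2 + 0)) = \<chi> t" for t
    using legendre_self_mult[of t] by (cases "[t = 0] (mod int p)")
      (auto simp: legendre_mult power2_eq_square legendre_0_iff)
  then show ?thesis by (simp add: jacobsthal_def sum_legendre)
qed

lemma legendre_minus:
  assumes "even n"
  shows "\<chi> (- t) = \<chi> t"
proof -
  have "\<chi> (-1) = 1" using assms by (intro legendre_eqI) auto
  then show ?thesis using legendre_mult[of "-1" t] by simp
qed

lemma cong_square_iff: "[s ^ 2 = t ^ 2] (mod int p) \<longleftrightarrow> [s = t] (mod int p) \<or> [s = - t] (mod int p)"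
proof -
  have "s ^ 2 - t ^ 2 = (s - t) * (s + t)"
    by (simp add: power2_eq_square algebra_simps)
  then show ?thesis
    using prime_p by (simp add: cong_iff_dvd_diff prime_dvd_mult_iff)
qed

text \<open>For t nonzero the solutions are s = t and s = p - t, distinct as p is odd; each
  contributes 1, since -1 is a square modulo p when n is even.\<close>

lemma sum_legendre_equal_squares:
  assumes "even n" "t \<in> {0..<int p}"
  shows "(\<Sum>s\<in>{0..<int p}. \<chi> t * \<chi> s * (if [t ^ 2 = s ^ 2] (mod int p) then 1 else 0))
     = (if t = 0 then 0 else 2)"
proof (cases "t = 0")
  case False
  have "{s\<in>{0..<int p}. [t ^ 2 = s ^ 2] (mod int p)} = {t, int p - t}"
  proof (intro equalityI subsetI)
    fix s assume s: "s \<in> {s\<in>{0..<int p}. [t ^ 2 = s ^ 2] (mod int p)}"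
    then consider "[t = s] (mod int p)" | "[t = - s] (mod int p)"
      by (auto simp: cong_square_iff)
    then show "s \<in> {t, int p - t}"
    proof cases
      case 1
      then have "t = s" using s assms by (intro cong_small_eq) auto
      then show ?thesis by simp
    next
      case 2
      then have "[int p - t = s] (mod int p)"
        using dvd_diff[of "int p" "int p" "t + s"] by (simp add: cong_iff_dvd_diff diff_diff_eq)
      then have "int p - t = s" using s assms False by (intro cong_small_eq) auto
      then show ?thesis by simp
    qed
  next
    fix s assume "s \<in> {t, int p - t}"
    then show "s \<in> {s\<in>{0..<int p}. [t ^ 2 = s ^ 2] (mod int p)}"
    proof
      assume "s = t"
      with assms show ?thesis by simp
    next
      assume "s \<in> {int p - t}"
      then have s: "s = int p - t" by simp
      then have "[t = - s] (mod int p)"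
        by (simp add: cong_iff_dvd_diff)
      moreover have "s \<in> {0..<int p}"
        using s assms False by auto
      ultimately show ?thesis by (simp add: cong_square_iff)
    qed
  qed
  moreover have "(\<Sum>s\<in>{0..<int p}. \<chi> t * \<chi> s * (if [t ^ 2 = s ^ 2] (mod int p) then 1 else 0))
     = (\<Sum>s\<in>{s\<in>{0..<int p}. [t ^ 2 = s ^ 2] (mod int p)}. \<chi> t * \<chi> s)"
    by (intro sum.mono_neutral_cong_right) auto
  moreover have "t \<noteq> int p - t" using odd_p by presburger
  moreover have "\<chi> (int p - t) = \<chi> t"
    using legendre_cong[of "int p - t" "- t"] legendre_minus[OF assms(1)] by (simp add: cong_iff_dvd_diff)
  moreover have "\<chi> t * \<chi> t = 1"
    using assms False by (intro legendre_self_mult) (simp add: residue_0_iff)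
  ultimately show ?thesis using False by simp
qed (simp add: legendre_0_iff)

text \<open>Expand the square and sum over a first: the quadratic sum over a is p - 1 if t^2 = s^2
  modulo p and -1 otherwise. The part from -1 factors into two vanishing sums; the rest is p times 2
  for each of the p - 1 nonzero t.\<close>

lemma sum_jacobsthal_square:
  assumes "even n"
  shows "(\<Sum>a\<in>{0..<int p}. jacobsthal a ^ 2) = 2 * int p * (int p - 1)"
proof -
  let ?R = "{0..<int p}"
  have "(\<Sum>a\<in>?R. jacobsthal a ^ 2)
      = (\<Sum>a\<in>?R. \<Sum>t\<in>?R. \<Sum>s\<in>?R. \<chi> t * \<chi> s * \<chi> ((a + t ^ 2) * (a + s ^ 2)))"
    unfolding jacobsthal_def power2_eq_square[of "sum _ _"] sum_product
    by (intro sum.cong refl) (simp add: legendre_mult mult_ac add.commute)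
  also have "\<dots> = (\<Sum>t\<in>?R. \<Sum>s\<in>?R. \<Sum>a\<in>?R. \<chi> t * \<chi> s * \<chi> ((a + t ^ 2) * (a + s ^ 2)))"
    by (subst sum.swap) (intro sum.cong refl sum.swap)
  also have "\<dots> = (\<Sum>t\<in>?R. \<Sum>s\<in>?R.
      int p * (\<chi> t * \<chi> s * (if [t ^ 2 = s ^ 2] (mod int p) then 1 else 0)) - \<chi> t * \<chi> s)"
    unfolding sum_distrib_left[symmetric] sum_legendre_quadratic
    by (intro sum.cong refl) (simp add: algebra_simps)
  also have "\<dots> = int p * (\<Sum>t\<in>?R. \<Sum>s\<in>?R. \<chi> t * \<chi> s * (if [t ^ 2 = s ^ 2] (mod int p) then 1 else 0))
      - (\<Sum>t\<in>?R. \<chi> t) * (\<Sum>s\<in>?R. \<chi> s)"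
    unfolding sum_subtractf sum_distrib_left[symmetric] sum_product ..
  also have "(\<Sum>t\<in>?R. \<Sum>s\<in>?R. \<chi> t * \<chi> s * (if [t ^ 2 = s ^ 2] (mod int p) then 1 else 0))
      = (\<Sum>t\<in>?R. if t = 0 then 0 else 2)"
    by (intro sum.cong refl sum_legendre_equal_squares assms)
  also have "\<dots> = 2 * (int p - 1)"
    using p_ge_3 by (simp add: residue_split)
  finally show ?thesis by (simp add: sum_legendre)
qed

lemma exists_nonresidue: obtains r where "\<chi> r = -1"
proof -
  have "\<exists>r\<in>{0..<int p}. \<chi> r = -1"
  proof (rule ccontr)
    assume "\<not> ?thesis"
    then have "\<chi> r \<ge> 0" if "r \<in> {0..<int p}" for r
      using that legendre_values[of r] by force
    then have "\<forall>r\<in>{0..<int p}. \<chi> r = 0"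
      using sum_legendre by (subst (asm) sum_nonneg_eq_0_iff) auto
    then have "\<chi> 1 = 0" using p_ge_3 by (intro bspec[of _ _ 1]) auto
    then show False by simp
  qed
  then show ?thesis using that by blast
qed

lemma jacobsthal_sum_two_squares:
  assumes "even n" "\<chi> r = -1"
  shows "jacobsthal 1 ^ 2 + jacobsthal r ^ 2 = 4 * int p"
proof -
  have r0: "\<not> [r = 0] (mod int p)" "\<not> [1 = 0] (mod int p)"
    using assms(2) legendre_1 by (metis legendre_0_iff neg_equal_0_iff_equal zero_neq_one)+
  have "2 * (\<Sum>a\<in>{0..<int p}. jacobsthal a ^ 2) = 2 * (\<Sum>a\<in>{1..<int p}. jacobsthal a ^ 2)"
    by (simp add: residue_split jacobsthal_0)
  \<comment> \<open>The weights are 2 and 0 on residues, 0 and 2 on nonresidues. They avoid counting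
    the two classes: their totals follow from \<open>sum_legendre\<close>.\<close>
  also have "\<dots> = (\<Sum>a\<in>{1..<int p}. (1 + \<chi> a) * jacobsthal 1 ^ 2 + (1 - \<chi> a) * jacobsthal r ^ 2)"
    unfolding sum_distrib_left
  proof (intro sum.cong refl)
    fix a assume "a \<in> {1..<int p}"
    then have "\<not> [a = 0] (mod int p)" by (auto simp: residue_0_iff)
    then consider "\<chi> a = \<chi> 1" | "\<chi> a = \<chi> r"
      using legendre_values[of a] assms(2) by (auto simp: legendre_0_iff)
    then show "2 * jacobsthal a ^ 2 = (1 + \<chi> a) * jacobsthal 1 ^ 2 + (1 - \<chi> a) * jacobsthal r ^ 2"
      using r0 assms(2) by cases (simp_all add: jacobsthal_square_eq)
  qed
  also have "\<dots> = (int p - 1 + (\<Sum>a\<in>{1..<int p}. \<chi> a)) * jacobsthal 1 ^ 2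
      + (int p - 1 - (\<Sum>a\<in>{1..<int p}. \<chi> a)) * jacobsthal r ^ 2"
    using p_ge_3 by (simp add: sum.distrib sum_subtractf flip: sum_distrib_right)
  also have "(\<Sum>a\<in>{1..<int p}. \<chi> a) = 0"
    using sum_legendre by (simp add: residue_split)
  finally have "(int p - 1) * (jacobsthal 1 ^ 2 + jacobsthal r ^ 2) = (int p - 1) * (4 * int p)"
    unfolding sum_jacobsthal_square[OF assms(1)] by (simp add: algebra_simps)
  then show ?thesis using p_ge_3 by simp
qed

section \<open>The half system {1..n} and the sign of the Jacobsthal sum\<close>

lemma half_system_unique:
  assumes "s \<in> {1..int n}" "t \<in> {1..int n}" "[s ^ 2 = t ^ 2] (mod int p)"
  shows "s = t"
  using assms(3) unfolding cong_square_iff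
proof
  assume "[s = t] (mod int p)"
  then show ?thesis using assms int_p_eq by (intro cong_small_eq) auto
next
  assume "[s = - t] (mod int p)"
  then have "s = - t" using assms int_p_eq by (intro cong_small_eq) auto
  with assms show ?thesis by auto
qed

text \<open>Equality of squares expresses equality up to sign: the representative is the residue of
  u or its reflection p - u.\<close>

lemma half_system_exists:
  assumes "\<not> [u = 0] (mod int p)"
  obtains s where "s \<in> {1..int n}" "[s ^ 2 = u ^ 2] (mod int p)"
proof (cases "u mod int p \<le> int n")
  case True
  have "u mod int p \<noteq> 0" using assms by (simp add: cong_def)
  moreover have "u mod int p \<ge> 0" using p_ge_3 by simp
  ultimately show ?thesis
    using True by (intro that[of "u mod int p"]) (auto simp: cong_def power_mod)
next
  case False
  have "u mod int p < int p" using p_ge_3 by simp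
  then have "int p - u mod int p \<in> {1..int n}"
    using False int_p_eq by simp
  moreover have "[int p - u mod int p = - u] (mod int p)"
    by (simp add: cong_def mod_simps)
  ultimately show ?thesis
    by (intro that[of "int p - u mod int p"]) (simp_all add: cong_square_iff)
qed

text \<open>The cubic is odd in t and -1 is a square modulo p, so t and p - t give equal
  terms.\<close>

lemma jacobsthal_half_sum:
  assumes "even n"
  shows "jacobsthal a = 2 * (\<Sum>t\<in>{1..int n}. \<chi> (t * (t ^ 2 + a)))"
proof -
  let ?f = "\<lambda>t. \<chi> (t * (t ^ 2 + a))"
  have "jacobsthal a = (\<Sum>t\<in>{1..<int p}. ?f t)"
    by (simp add: jacobsthal_def residue_split)
  also have "{1..<int p} = {1..int n} \<union> {int n + 1..<int p}"
    using int_p_eq by auto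
  also have "(\<Sum>t\<in>\<dots>. ?f t) = (\<Sum>t\<in>{1..int n}. ?f t) + (\<Sum>t\<in>{int n + 1..<int p}. ?f t)"
    by (rule sum.union_disjoint) auto
  also have "(\<Sum>t\<in>{int n + 1..<int p}. ?f t) = (\<Sum>t\<in>{1..int n}. ?f t)"
  proof (rule sum.reindex_bij_witness[where i = "\<lambda>t. int p - t" and j = "\<lambda>t. int p - t"])
    fix t
    have "[(int p - t) * ((int p - t) ^ 2 + a) = - t * ((- t) ^ 2 + a)] (mod int p)"
      by (intro cong_mult cong_add cong_pow cong_refl) (simp_all add: cong_iff_dvd_diff)
    then show "?f (int p - t) = ?f t"
      using legendre_cong legendre_minus[OF assms, of "t * (t ^ 2 + a)"] by fastforce
  qed (use int_p_eq in auto)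
  finally show ?thesis by simp
qed

text \<open>This decides the sign of x. The terms are invariant under inversion up to sign, whose
  fixed points are 1 and a root i of -1. Elsewhere they are 1 or -1, with an even number of -1, so
  they add up to n - 2 modulo 4. The term at i is 0 and the term at 1 is the symbol of 2.\<close>

lemma jacobsthal_1_half_mod_4:
  assumes "even n"
  shows "[(\<Sum>t\<in>{1..int n}. \<chi> (t * (t ^ 2 + 1))) = 3] (mod 4)"
proof -
  define f where "f t = \<chi> (t * (t ^ 2 + 1))" for t
  have "\<chi> (-1) = 1"
    using legendre_minus[OF assms, of 1] by simp
  then obtain i0 where i0: "[i0 ^ 2 = -1] (mod int p)"
    unfolding legendre_eq_1_iff by blast
  have not0: "\<not> [1 = 0] (mod int p)" "\<not> [-1 = 0] (mod int p)"
    using p_ge_3 by (auto simp: cong_0_iff zdvd1_eq)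
  then have "\<not> [i0 = 0] (mod int p)"
    using cong_pow[of i0 0 "int p" 2] cong_trans[OF cong_sym[OF i0]] by auto
  then obtain i where i: "i \<in> {1..int n}" and "[i ^ 2 = i0 ^ 2] (mod int p)"
    by (rule half_system_exists)
  then have i2: "[i ^ 2 = -1] (mod int p)"
    using i0 cong_trans by blast
  have nonzero: "\<not> [t = 0] (mod int p)" if "t \<in> {1..int n}" for t
    using that int_p_eq residue_0_iff[of t] by auto
  have one: "1 \<in> {1..int n}" using n_pos by simp
  have "i \<noteq> 1"
    using i2 cong_iff_dvd_diff[of 1 "-1" "int p"] p_ge_3 zdvd_imp_le[of "int p" 2] by auto
  define B where "B = {1..int n} - {1, i}"
  have f_i: "f i = 0"
    using cong_mult[OF cong_refl[of i] cong_add[OF i2 cong_refl[of 1]]]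
    by (simp add: f_def legendre_0_iff)
  have f_1: "f 1 = (-1) ^ (n div 2)"
  proof -
    \<comment> \<open>This shows that 2 and i have the same symbol, and Euler's criterion evaluates
      that of i as i^n = (-1)^(n/2).\<close>
    have "[(1 + i) * (1 + i) = 2 * i] (mod int p)"
      using i2 by (simp add: cong_iff_dvd_diff power2_eq_square algebra_simps)
    then have "\<chi> (1 + i) * \<chi> (1 + i) = \<chi> 2 * \<chi> i"
      using legendre_cong by (simp only: legendre_mult[symmetric])
    moreover have "\<chi> 2 \<noteq> 0" "\<chi> i \<noteq> 0"
      using p_ge_3 not_cong_0_int[of 2] nonzero[OF i] by (auto simp: legendre_0_iff)
    ultimately have "\<chi> 2 = \<chi> i"
      using legendre_values[of 2] legendre_values[of i] legendre_values[of "1 + i"]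
      by auto
    also have "\<chi> i = (-1) ^ (n div 2)"
    proof (rule legendre_eqI)
      have "[(i ^ 2) ^ (n div 2) = (-1) ^ (n div 2)] (mod int p)"
        using i2 by (rule cong_pow)
      moreover have "(i ^ 2) ^ (n div 2) = i ^ n"
        using assms by (simp only: power_mult[symmetric] dvd_mult_div_cancel)
      ultimately show "[i ^ n = (-1) ^ (n div 2)] (mod int p)" by simp
      show "(-1) ^ (n div 2) = (0 :: int) \<or> (-1) ^ (n div 2) = (1 :: int) \<or> (-1) ^ (n div 2) = (-1 :: int)"
        by (cases "even (n div 2)") auto
    qed
    finally show ?thesis by (simp add: f_def)
  qed
  \<comment> \<open>\<open>g\<close> is the involution \<open>t \<mapsto> \<plusminus>1/t\<close> of the half system; it preserves \<open>f\<close> and fixes only \<open>1\<close> and \<open>i\<close>.\<close>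
  define g where "g t = (SOME s. s \<in> {1..int n} \<and> [(t * s) ^ 2 = 1] (mod int p))" for t
  have g: "g t \<in> {1..int n}" "[(t * g t) ^ 2 = 1] (mod int p)" if t: "t \<in> {1..int n}" for t
  proof -
    obtain u where u: "[t * u = 1] (mod int p)"
      by (rule obtain_inverse[OF nonzero[OF t]])
    obtain s where s: "s \<in> {1..int n}" "[s ^ 2 = u ^ 2] (mod int p)"
      by (rule half_system_exists[OF inverse_not_cong_0(2)[OF u]])
    have "[t ^ 2 * s ^ 2 = t ^ 2 * u ^ 2] (mod int p)"
      using s(2) by (rule cong_scalar_left)
    also have "t ^ 2 * u ^ 2 = (t * u) ^ 2" by (simp add: power_mult_distrib)
    also have "[\<dots> = 1 ^ 2] (mod int p)" using u by (rule cong_pow)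
    finally have "[(t * s) ^ 2 = 1] (mod int p)" by (simp add: power_mult_distrib)
    with s(1) have "\<exists>s. s \<in> {1..int n} \<and> [(t * s) ^ 2 = 1] (mod int p)" by blast
    from someI_ex[OF this] show "g t \<in> {1..int n}" "[(t * g t) ^ 2 = 1] (mod int p)"
      unfolding g_def by auto
  qed
  have g_unique: "g t = s" if "t \<in> {1..int n}" "s \<in> {1..int n}" "[(t * s) ^ 2 = 1] (mod int p)" for s t
  proof (rule half_system_unique[OF g(1)[OF that(1)] that(2)])
    have "[t ^ 2 * g t ^ 2 = t ^ 2 * s ^ 2] (mod int p)"
      using cong_trans[OF g(2)[OF that(1)] cong_sym[OF that(3)]] by (simp add: power_mult_distrib)
    moreover have "\<not> [t ^ 2 = 0] (mod int p)"
      using nonzero[OF that(1)] prime_p by (simp add: cong_0_iff prime_dvd_power_iff)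
    ultimately show "[g t ^ 2 = s ^ 2] (mod int p)"
      using cong_cancel by blast
  qed
  have gg: "g (g t) = t" if "t \<in> {1..int n}" for t
    using g[OF that] by (intro g_unique that) (simp_all add: mult.commute)
  have g_1: "g 1 = 1" by (intro g_unique one) simp
  have g_i: "g i = i"
  proof (intro g_unique i)
    have "[i ^ 2 * i ^ 2 = (-1) * (-1)] (mod int p)"
      by (intro cong_mult i2)
    then show "[(i * i) ^ 2 = 1] (mod int p)" by (simp add: power2_eq_square)
  qed
  have g_fix: "t = 1 \<or> t = i" if "t \<in> {1..int n}" "g t = t" for t
  proof -
    have "[(t ^ 2) ^ 2 = 1 ^ 2] (mod int p)"
      using g(2)[OF that(1)] that(2) by (simp add: power2_eq_square)
    then have "[t ^ 2 = 1] (mod int p) \<or> [t ^ 2 = -1] (mod int p)"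
      unfolding cong_square_iff .
    then have "[t ^ 2 = 1 ^ 2] (mod int p) \<or> [t ^ 2 = i ^ 2] (mod int p)"
      using cong_trans[OF _ cong_sym[OF i2]] by auto
    then show ?thesis
      using half_system_unique that(1) one i by blast
  qed
  have g_B: "g t \<in> B \<and> g (g t) = t \<and> g t \<noteq> t" if "t \<in> B" for t
  proof -
    have t: "t \<in> {1..int n}" "t \<noteq> 1" "t \<noteq> i" using that by (auto simp: B_def)
    then show ?thesis
      using g(1)[OF t(1)] gg[OF t(1)] g_fix[OF t(1)] g_1 g_i unfolding B_def
      by (metis Diff_iff insert_iff empty_iff)
  qed
  have f_g: "f (g t) = f t" if "t \<in> {1..int n}" for t
  proof -
    define s where "s = g t"
    have ts: "[(t * s) ^ 2 = 1] (mod int p)" and s: "s \<in> {1..int n}"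
      using g[OF that] by (simp_all add: s_def)
    then have "[t * s = 1] (mod int p) \<or> [t * s = -1] (mod int p)"
      using cong_square_iff[of "t * s" 1] by simp
    then have "\<chi> (t * s) = 1"
      using legendre_cong \<open>\<chi> (-1) = 1\<close> legendre_1 by metis
    then have "\<chi> t = \<chi> s"
      using legendre_values[of t] legendre_values[of s] by (auto simp: legendre_mult)
    \<comment> \<open>With (t s)^2 = 1, the values s^2 + 1 and t^2 + 1 differ by the square factor
      s^2.\<close>
    have "[s ^ 2 + (t * s) ^ 2 = s ^ 2 + 1] (mod int p)"
      by (intro cong_add cong_refl ts)
    moreover have "s ^ 2 + (t * s) ^ 2 = s * s * (t ^ 2 + 1)"
      by (simp add: power2_eq_square algebra_simps)
    ultimately have "\<chi> (s ^ 2 + 1) = \<chi> (s * s * (t ^ 2 + 1))"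
      using legendre_cong by metis
    also have "\<dots> = \<chi> (t ^ 2 + 1)"
      using legendre_self_mult[OF nonzero[OF s]] by (simp add: legendre_mult)
    finally show ?thesis
      using \<open>\<chi> t = \<chi> s\<close> by (simp add: f_def s_def legendre_mult)
  qed
  have f_B: "f t = 1 \<or> f t = -1" if "t \<in> B" for t
  proof -
    have t: "t \<in> {1..int n}" "t \<noteq> i" using that by (auto simp: B_def)
    have "\<not> [t ^ 2 + 1 = 0] (mod int p)"
    proof
      assume "[t ^ 2 + 1 = 0] (mod int p)"
      then have "[t ^ 2 = i ^ 2] (mod int p)"
        using cong_trans[OF _ cong_sym[OF i2], of "t ^ 2"] by (simp add: cong_iff_dvd_diff)
      then show False using half_system_unique t i by blast
    qed
    then have "\<not> [t * (t ^ 2 + 1) = 0] (mod int p)"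
      using nonzero[OF t(1)] cong_mult_0 by blast
    then show ?thesis
      using legendre_values[of "t * (t ^ 2 + 1)"] by (auto simp: f_def legendre_0_iff)
  qed
  define N where "N = {t \<in> B. f t = -1}"
  have "finite B" by (simp add: B_def)
  have "g t \<in> N \<and> g (g t) = t \<and> g t \<noteq> t" if "t \<in> N" for t
    using that g_B[of t] f_g[of t] by (auto simp: N_def B_def)
  then have "even (card N)"
    using \<open>finite B\<close> by (intro even_card_involution[of N g]) (auto simp: N_def)
  then obtain q where q: "card N = 2 * q" by (elim evenE)
  have "(\<Sum>t\<in>B. f t) = (\<Sum>t\<in>B. 1 - 2 * (if t \<in> N then 1 else 0))"
    using f_B by (intro sum.cong refl) (auto simp: N_def)
  also have "\<dots> = int (card B) - 2 * int (card N)"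
  proof -
    have "(\<Sum>t\<in>B. if t \<in> N then 1 else 0) = int (card N)"
      using \<open>finite B\<close> by (subst sum.If_cases) (auto simp: N_def intro: arg_cong[of _ _ card])
    then show ?thesis by (simp add: sum_subtractf flip: sum_distrib_left)
  qed
  also have "int (card B) = int n - 2"
    using one i \<open>i \<noteq> 1\<close> by (simp add: B_def card_Diff_subset of_nat_diff)
  finally have "(\<Sum>t\<in>B. f t) = int n - 2 - 4 * int q"
    using q by simp
  moreover have "(\<Sum>t\<in>{1..int n}. f t) = f 1 + (f i + (\<Sum>t\<in>B. f t))"
    using one i \<open>i \<noteq> 1\<close> unfolding B_def
    by (subst sum.remove[of _ 1], simp, simp, subst sum.remove[of _ i]) (auto intro!: sum.cong)
  ultimately have *: "(\<Sum>t\<in>{1..int n}. f t) = (-1) ^ (n div 2) + int n - 2 - 4 * int q"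
    using f_1 f_i by simp
  obtain e where e: "n = 2 * e" using assms by (elim evenE)
  \<comment> \<open>The parity of e = n/2 cancels: (-1)^e + 2 e is 1 modulo 4 in both cases.\<close>
  have "[(-1) ^ e + 2 * int e - 2 - 4 * int q = 3] (mod 4)"
  proof (cases "even e")
    case True
    then obtain l where "e = 2 * l" by (elim evenE)
    then have "(-1) ^ e + 2 * int e - 2 - 4 * int q - 3 = 4 * (int l - int q - 1)" by simp
    then show ?thesis by (metis cong_iff_dvd_diff dvd_triv_left)
  next
    case False
    then obtain l where "e = 2 * l + 1" by (elim oddE)
    then have "(-1) ^ e + 2 * int e - 2 - 4 * int q - 3 = 4 * (int l - int q - 1)" by simp
    then show ?thesis by (metis cong_iff_dvd_diff dvd_triv_left)
  qed
  with * e show ?thesis by (simp add: f_def)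
qed

text \<open>Minus half of \<open>jacobsthal 1\<close> is 1 modulo 4 and occurs in a representation
  of p as a sum of two squares, so by uniqueness it equals x; the congruence for
  \<open>jacobsthal 1\<close> then carries over.\<close>

theorem gauss_central_binomial_cong:
  assumes "even n" "int p = x ^ 2 + y ^ 2" "[x = 1] (mod 4)"
  shows "[int (n choose (n div 2)) = 2 * x] (mod int p)"
proof -
  obtain r where r: "\<chi> r = -1" by (rule exists_nonresidue)
  define H where "H a = (\<Sum>t\<in>{1..int n}. \<chi> (t * (t ^ 2 + a)))" for a
  have J: "jacobsthal a = 2 * H a" for a
    using jacobsthal_half_sum[OF assms(1)] by (simp add: H_def)
  have "int p = (- H 1) ^ 2 + H r ^ 2"
    using jacobsthal_sum_two_squares[OF assms(1) r] by (simp add: J power_mult_distrib)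
  moreover have "[- H 1 = 1] (mod 4)"
    using jacobsthal_1_half_mod_4[OF assms(1)] unfolding H_def[symmetric]
    unfolding cong_iff_dvd_diff by presburger
  moreover have "prime (int p)" using prime_p by simp
  ultimately have "- H 1 = x"
    by (intro prime_sum_two_squares_unique[OF _ assms(2) _ assms(3)])
  have "[- jacobsthal 1 = int (n choose (n div 2))] (mod int p)"
    using cong_diff[OF cong_refl[of 0] jacobsthal_1_cong[OF assms(1)]] by simp
  then have "[int (n choose (n div 2)) = - jacobsthal 1] (mod int p)"
    by (rule cong_sym)
  moreover have "- jacobsthal 1 = 2 * x"
    using J[of 1] \<open>- H 1 = x\<close> by simp
  ultimately show ?thesis by simp
qed

end

section \<open>Transfer of the integer congruences to rational numbers\<close>

theorem theorem2p1:
  fixes p :: nat and m b c :: int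
  assumes "prime p" and "odd p" and "\<not> [m = 0] (mod int p)"
  shows
    "([m = 4 * b] (mod int p) \<longrightarrow>
        ([p = 1] (mod 4) \<longrightarrow>
          (\<forall>x y :: int. int p = x ^ 2 + y ^ 2 \<and> [x = 1] (mod 4) \<longrightarrow>
            rat_cong p
              (\<Sum>k=0..p-1. of_nat ((2 * k) choose k) / of_int m ^ k
                 * of_int (central_trinomial b c k))
              (of_int (Legendre m (int p)) * (2 * of_int x) * of_int c ^ ((p - 1) div 4)))) \<and>
        ([p = 3] (mod 4) \<longrightarrow>
          rat_cong p
            (\<Sum>k=0..p-1. of_nat ((2 * k) choose k) / of_int m ^ k
               * of_int (central_trinomial b c k))
            0))
     \<and>
     (\<not> [m = 4 * b] (mod int p) \<longrightarrow>
        rat_cong p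
          (\<Sum>k=0..p-1. of_nat ((2 * k) choose k) / of_int m ^ k
             * of_int (central_trinomial b c k))
          (of_int (Legendre (m * (m - 4 * b)) (int p)) *
           (\<Sum>k=0..p-1. of_nat ((4 * k) choose (2 * k)) * of_nat ((2 * k) choose k) * of_int c ^ k
              / of_int (m - 4 * b) ^ (2 * k))))
     \<and>
     (\<forall>d :: int. d = b ^ 2 - 4 * c \<and> \<not> [d = 0] (mod int p) \<longrightarrow>
        (\<forall>h :: nat. h > 0 \<longrightarrow>
          rat_cong p
            (\<Sum>k=0..p-1. of_nat ((2 * k) choose k) ^ h * of_int (central_trinomial b c (2 * k))
               / of_int m ^ k)
            (of_int (Legendre ((-1) ^ h * d * m) (int p)) *
             (\<Sum>k=0..p-1. of_nat ((2 * k) choose k) ^ h * of_int (central_trinomial b c (2 * k))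
                / (16 ^ h * of_int d ^ 2 / of_int m) ^ k))))"
proof -
  interpret odd_prime_modulus p
    using assms by unfold_locales
  obtain v where v: "[m * v = 1] (mod int p)"
    using obtain_inverse[OF assms(3)] .
  \<comment> \<open>An integer representative of the left-hand side shared by (1) and (2).\<close>
  define S where "S = (\<Sum>k=0..p-1. int ((2 * k) choose k) * v ^ k * central_trinomial b c k)"
  have S: "rat_cong p
      (\<Sum>k=0..p-1. of_nat ((2 * k) choose k) / of_int m ^ k * of_int (central_trinomial b c k)) (of_int S)"
    unfolding S_def
  proof (rule rat_cong_sum_of_int[OF prime_p])
    fix k
    show "rat_cong p (of_nat ((2 * k) choose k) / of_int m ^ k * of_int (central_trinomial b c k))
        (of_int (int ((2 * k) choose k) * v ^ k * central_trinomial b c k))"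
      using rat_cong_of_int_inverse_power[OF prime_p v,
          of "int ((2 * k) choose k) * central_trinomial b c k" k]
      by (simp add: divide_inverse power_inverse mult_ac)
  qed
  have "rat_cong p (\<Sum>k=0..p-1. of_nat ((2 * k) choose k) / of_int m ^ k * of_int (central_trinomial b c k))
      (of_int (Legendre m (int p)) * (2 * of_int x) * of_int c ^ ((p - 1) div 4))"
    if "[m = 4 * b] (mod int p)" "[p = 1] (mod 4)" "int p = x ^ 2 + y ^ 2" "[x = 1] (mod 4)" for x y :: int
  proof (rule rat_cong_via_int[OF prime_p S])
    have "even n"
      using that(2) unfolding n_def cong_def by presburger
    have "[S = Legendre m (int p) * int (n choose (n div 2)) * c ^ (n div 2)] (mod int p)"
      using binomial_trinomial_sum_degenerate_cong[OF v that(1)] \<open>even n\<close> by (simp add: S_def)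
    moreover have "[Legendre m (int p) * int (n choose (n div 2)) * c ^ (n div 2)
        = Legendre m (int p) * (2 * x) * c ^ (n div 2)] (mod int p)"
      by (intro cong_mult cong_refl gauss_central_binomial_cong[OF \<open>even n\<close> that(3,4)])
    moreover have "n div 2 = (p - 1) div 4"
      by (simp add: n_def flip: div_mult2_eq)
    ultimately show "[S = Legendre m (int p) * (2 * x) * c ^ ((p - 1) div 4)] (mod int p)"
      using cong_trans by simp
    show "rat_cong p (of_int (Legendre m (int p)) * (2 * of_int x) * of_int c ^ ((p - 1) div 4))
        (of_int (Legendre m (int p) * (2 * x) * c ^ ((p - 1) div 4)))"
      using rat_cong_of_int[OF cong_refl, of p "Legendre m (int p) * (2 * x) * c ^ ((p - 1) div 4)"] by simp
  qed
  moreover have "rat_cong p (\<Sum>k=0..p-1. of_nat ((2 * k) choose k) / of_int m ^ k * of_int (central_trinomial b c k)) 0"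
    if "[m = 4 * b] (mod int p)" "[p = 3] (mod 4)"
  proof (rule rat_cong_via_int[OF prime_p S])
    have "odd n"
      using that(2) unfolding n_def cong_def by presburger
    then show "[S = 0] (mod int p)"
      using binomial_trinomial_sum_degenerate_cong[OF v that(1)] by (simp add: S_def)
    show "rat_cong p 0 (of_int 0)"
      using rat_cong_of_int[OF cong_refl, of p 0] by simp
  qed
  moreover have "rat_cong p (\<Sum>k=0..p-1. of_nat ((2 * k) choose k) / of_int m ^ k * of_int (central_trinomial b c k))
      (of_int (Legendre (m * (m - 4 * b)) (int p)) *
       (\<Sum>k=0..p-1. of_nat ((4 * k) choose (2 * k)) * of_nat ((2 * k) choose k) * of_int c ^ k
          / of_int (m - 4 * b) ^ (2 * k)))"
    if "\<not> [m = 4 * b] (mod int p)"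
  proof -
    have "\<not> [m - 4 * b = 0] (mod int p)"
      using that by (simp add: cong_iff_dvd_diff)
    then obtain w where w: "[(m - 4 * b) * w = 1] (mod int p)"
      by (rule obtain_inverse)
    show ?thesis
    proof (rule rat_cong_via_int[OF prime_p S])
      show "[S = Legendre (m * (m - 4 * b)) (int p) *
          (\<Sum>k=0..p-1. int ((4 * k) choose (2 * k)) * int ((2 * k) choose k) * c ^ k * w ^ (2 * k))] (mod int p)"
        unfolding S_def by (rule binomial_trinomial_sum_nondegenerate_cong[OF v refl w])
      show "rat_cong p (of_int (Legendre (m * (m - 4 * b)) (int p)) *
         (\<Sum>k=0..p-1. of_nat ((4 * k) choose (2 * k)) * of_nat ((2 * k) choose k) * of_int c ^ k
          / of_int (m - 4 * b) ^ (2 * k)))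
         (of_int (Legendre (m * (m - 4 * b)) (int p) *
          (\<Sum>k=0..p-1. int ((4 * k) choose (2 * k)) * int ((2 * k) choose k) * c ^ k * w ^ (2 * k))))"
        unfolding of_int_mult[of "Legendre _ _"]
      proof (intro rat_cong_mult[OF prime_p rat_cong_of_int[OF cong_refl]] rat_cong_sum_of_int[OF prime_p])
        fix k
        show "rat_cong p (of_nat ((4 * k) choose (2 * k)) * of_nat ((2 * k) choose k) * of_int c ^ k
            / of_int (m - 4 * b) ^ (2 * k))
          (of_int (int ((4 * k) choose (2 * k)) * int ((2 * k) choose k) * c ^ k * w ^ (2 * k)))"
          using rat_cong_of_int_inverse_power[OF prime_p w,
              of "int ((4 * k) choose (2 * k)) * int ((2 * k) choose k) * c ^ k" "2 * k"]
          by (simp add: divide_inverse power_inverse)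
      qed
    qed
  qed
  moreover have "rat_cong p
      (\<Sum>k=0..p-1. of_nat ((2 * k) choose k) ^ h * of_int (central_trinomial b c (2 * k)) / of_int m ^ k)
      (of_int (Legendre ((-1) ^ h * d * m) (int p)) *
       (\<Sum>k=0..p-1. of_nat ((2 * k) choose k) ^ h * of_int (central_trinomial b c (2 * k))
          / (16 ^ h * of_int d ^ 2 / of_int m) ^ k))"
    if d: "d = b ^ 2 - 4 * c" "\<not> [d = 0] (mod int p)" and "h > 0" for d h
  proof -
    have "\<not> [2 = 0] (mod int p)"
      using p_ge_3 by (intro not_cong_0_int) auto
    then have "\<not> [(2 ^ 4) ^ h * d ^ 2 = 0] (mod int p)"
      using d(2) prime_p unfolding power_mult[symmetric]
      by (auto simp: cong_0_iff prime_dvd_mult_iff dest: prime_dvd_power[rotated])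
    then obtain z where z: "[16 ^ h * d ^ 2 * z = 1] (mod int p)"
      by (rule obtain_inverse) simp
    \<comment> \<open>Modulo p this is the reciprocal of 16^h d^2/m, so its powers stand for the
      division on the right of (3).\<close>
    define w where "w = m * z"
    have w: "[16 ^ h * d ^ 2 * w = m] (mod int p)"
      using cong_scalar_left[OF z, of m] by (simp add: w_def mult_ac)
    have inv: "rat_cong p (inverse (16 ^ h * of_int d ^ 2 / of_int m)) (of_int w)"
      using rat_cong_of_int_inverse_power[OF prime_p z, of m 1]
      by (simp add: w_def inverse_eq_divide)
    show ?thesis
    proof (rule rat_cong_via_int[OF prime_p])
      show "[(\<Sum>k=0..p-1. int ((2 * k) choose k) ^ h * central_trinomial b c (2 * k) * v ^ k)
          = Legendre ((-1) ^ h * d * m) (int p) *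
            (\<Sum>k=0..p-1. int ((2 * k) choose k) ^ h * central_trinomial b c (2 * k) * w ^ k)] (mod int p)"
        by (rule binomial_power_trinomial_sum_cong[OF v d w \<open>h > 0\<close>])
      show "rat_cong p
          (\<Sum>k=0..p-1. of_nat ((2 * k) choose k) ^ h * of_int (central_trinomial b c (2 * k)) / of_int m ^ k)
          (of_int (\<Sum>k=0..p-1. int ((2 * k) choose k) ^ h * central_trinomial b c (2 * k) * v ^ k))"
      proof (rule rat_cong_sum_of_int[OF prime_p])
        fix k
        show "rat_cong p (of_nat ((2 * k) choose k) ^ h * of_int (central_trinomial b c (2 * k)) / of_int m ^ k)
            (of_int (int ((2 * k) choose k) ^ h * central_trinomial b c (2 * k) * v ^ k))"
          using rat_cong_of_int_inverse_power[OF prime_p v,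
              of "int ((2 * k) choose k) ^ h * central_trinomial b c (2 * k)" k]
          by (simp add: divide_inverse power_inverse)
      qed
      show "rat_cong p (of_int (Legendre ((-1) ^ h * d * m) (int p)) *
         (\<Sum>k=0..p-1. of_nat ((2 * k) choose k) ^ h * of_int (central_trinomial b c (2 * k))
            / (16 ^ h * of_int d ^ 2 / of_int m) ^ k))
         (of_int (Legendre ((-1) ^ h * d * m) (int p) *
           (\<Sum>k=0..p-1. int ((2 * k) choose k) ^ h * central_trinomial b c (2 * k) * w ^ k)))"
        unfolding of_int_mult[of "Legendre _ _"]
      proof (intro rat_cong_mult[OF prime_p rat_cong_of_int[OF cong_refl]] rat_cong_sum_of_int[OF prime_p])
        fix k
        let ?u = "int ((2 * k) choose k) ^ h * central_trinomial b c (2 * k)"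
        have "rat_cong p (of_int ?u * inverse (16 ^ h * of_int d ^ 2 / of_int m) ^ k) (of_int ?u * of_int w ^ k)"
          by (intro rat_cong_mult[OF prime_p rat_cong_of_int[OF cong_refl]] rat_cong_power[OF prime_p] inv)
        then show "rat_cong p (of_nat ((2 * k) choose k) ^ h * of_int (central_trinomial b c (2 * k))
            / (16 ^ h * of_int d ^ 2 / of_int m) ^ k) (of_int (?u * w ^ k))"
          by (simp add: divide_inverse[of _ "_ ^ k"] power_inverse del: inverse_divide)
      qed
    qed
  qed
  ultimately show ?thesis by blast
qed

end
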